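(* Let $N$ be a positive integer. There exist $(A,B,C)\in C^\infty(\mathbb{R})^3$ (real-valued functions) and $\delta_A\in(0,1/2)$ such that (i) the supports of $A$, $B$ and $C$ are included in $[-1,1]$; (ii) $\{z:\ z>0,\ B(z)\neq0\text{ and }C(z)\neq0\}\neq\emptyset$; (iii) $A(z)=A(-z)$, $B(z)=B(-z)$, $C(z)=C(-z)$ for all $z\in\mathbb{R}$; (iv) $A(z)=e^{-1/(1-z^2)}$ if $1-\delta_A<z<1$; (v) $-A''-\frac{N-1}{z}A'=B^3$ in $\mathbb{R}^*$; (vi) $-B''-\frac{N-1}{z}B'=C^3$ in $\mathbb{R}^*$; (vii) for every $z\in\mathbb{R}$: $\left(B(z)=0\text{ and }z\in[0,1)\right)\Leftrightarrow z=\frac12$; (viii) $B'\left(\frac12\right)<0$; (ix) $C\left(\frac12\right)>0$; (x) for every $z\in\mathbb{R}$: $\left(C(z)=0\text{ and }z\in[0,1)\right)\Rightarrow\left(z\in(0,1)\text{ and }C'(z)\neq0\right)$.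
   Context: $\mathbb{R}^*=\mathbb{R}\setminus\{0\}$. *)

theory Defs
  imports "HOL-Analysis.Analysis"
begin

(* deriv is a choice operator, but differentiability of the n-th iterate is
   required for every n, so each iterate is a genuine derivative of the previous one. *)
definition C_infinity :: "(real \<Rightarrow> real) set" where
  "C_infinity = {f. \<forall>n x. (deriv ^^ n) f differentiable (at x)}"

definition supp :: "(real \<Rightarrow> real) \<Rightarrow> real set" where
  "supp f = closure (support_on UNIV f)"

end

theory Submission
  imports Defs "HOL-Computational_Algebra.Polynomial"
begin

text \<open>
  Everything is built from the even source \<open>D = C\<^sup>3\<close>: for \<open>m = N - 1\<close> the radial equation \<open>-\<Delta>u = f\<close> on
  \<open>z > 0\<close> is solved by two integrations, \<open>u = pot m f\<close>, and one takes \<open>B = pot m D\<close>, \<open>A = pot m (B\<^sup>3)\<close>.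
  If \<open>D\<close> has sign pattern \<open>+, -, +\<close> on \<open>[0,1)\<close> with triple zeros at \<open>a > 1/2\<close> and \<open>b\<close>, then \<open>C\<close> is smooth
  with simple zeros, and the only integral conditions left are \<open>flux m D 1 = 0\<close> and
  \<open>flux m (B\<^sup>3) 1 = 0\<close> (so that everything vanishes beyond 1) and \<open>B (1/2) = 0\<close>; the signs of \<open>B\<close> are then
  automatic. Near \<open>z = 1\<close>, \<open>D\<close> is forced by \<open>A = exp (-1/(1-z\<^sup>2))\<close>; since
  all conditions are homogeneous this germ may be scaled by a small \<open>k > 0\<close>. So \<open>D\<close> is a multiple of
  \<open>k F + \<mu> \<psi> - M + \<rho> R\<close> with \<open>F\<close> a fixed function carrying the germs and \<open>\<psi>, M, R \<ge> 0\<close> bumps in the three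
  intervals. The coefficients \<open>\<mu>, \<rho>\<close> solve the two linear conditions. For \<open>k = 0\<close> the cubic condition has
  either sign, according to whether \<open>\<psi>\<close> sits far from \<open>1/2\<close> (while \<open>M\<close> is close to \<open>1/2\<close>) or very close to
  it; this persists for small \<open>k\<close>, and the intermediate value theorem along the segment between the two
  choices of \<open>\<psi>\<close> concludes.
\<close>

subsection \<open>Smooth functions of one real variable\<close>

text \<open>Derivatives are existential witnesses rather than iterates of \<open>deriv\<close>, so
  the sum, product and chain rules are plain inductions on \<open>n\<close>. They are two-sided,
  hence \<open>S\<close> is meant to be open; asking for every \<open>n\<close> in
  \<open>smooth\<close> yields continuity of each derivative.\<close>

fun times_diff :: "nat \<Rightarrow> real set \<Rightarrow> (real \<Rightarrow> real) \<Rightarrow> bool" where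
  "times_diff 0 S f \<longleftrightarrow> True"
| "times_diff (Suc n) S f \<longleftrightarrow>
     (\<exists>f'. (\<forall>x\<in>S. (f has_real_derivative f' x) (at x)) \<and> times_diff n S f')"

definition smooth :: "real set \<Rightarrow> (real \<Rightarrow> real) \<Rightarrow> bool" where
  "smooth S f \<longleftrightarrow> (\<forall>n. times_diff n S f)"

lemma times_diff_SucI:
  "\<forall>x\<in>S. (f has_real_derivative f' x) (at x) \<Longrightarrow> times_diff n S f' \<Longrightarrow> times_diff (Suc n) S f"
  by auto

lemma times_diff_mono: "times_diff (Suc n) S f \<Longrightarrow> times_diff n S f"
proof (induction n arbitrary: f)
  case (Suc n)
  from Suc.prems obtain f' where "\<forall>x\<in>S. (f has_real_derivative f' x) (at x)" "times_diff (Suc n) S f'"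
    unfolding times_diff.simps(2)[of "Suc n"] by blast
  then show ?case using Suc.IH[of f'] unfolding times_diff.simps(2)[of n S f] by blast
qed simp

lemma times_diff_cong:
  assumes "open S" "times_diff n S f" "\<And>x. x \<in> S \<Longrightarrow> f x = g x"
  shows "times_diff n S g"
proof (cases n)
  case (Suc m)
  with assms obtain f' where f': "\<forall>x\<in>S. (f has_real_derivative f' x) (at x)" "times_diff m S f'"
    by auto
  have "\<forall>x\<in>S. (g has_real_derivative f' x) (at x)"
    using f' assms by (metis has_field_derivative_transform_within_open)
  with f' Suc show ?thesis by auto
qed auto

lemma times_diff_subset: "times_diff n T f \<Longrightarrow> S \<subseteq> T \<Longrightarrow> times_diff n S f"
proof (induction n arbitrary: f)
  case (Suc n)
  then show ?case unfolding times_diff.simps(2) by blast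
qed simp

text \<open>Smoothness is local: all local derivatives agree with \<open>deriv f\<close>, which
  therefore serves on the whole union. Piecewise descriptions are later glued by this.\<close>

lemma times_diff_Union:
  assumes "\<And>S. S \<in> \<F> \<Longrightarrow> open S" "\<And>S. S \<in> \<F> \<Longrightarrow> times_diff n S f"
  shows "times_diff n (\<Union>\<F>) f"
  using assms(2)
proof (induction n arbitrary: f)
  case (Suc n)
  have *: "(\<forall>x\<in>S. (f has_real_derivative deriv f x) (at x)) \<and> times_diff n S (deriv f)" if S: "S \<in> \<F>" for S
  proof -
    obtain f' where f': "\<forall>x\<in>S. (f has_real_derivative f' x) (at x)" "times_diff n S f'"
      using Suc.prems[OF S] by auto
    have eq: "\<And>x. x \<in> S \<Longrightarrow> f' x = deriv f x"
      using f' DERIV_imp_deriv by metis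
    then show ?thesis using f'(1) times_diff_cong[OF assms(1)[OF S] f'(2), of "deriv f"] by simp
  qed
  then show ?case using Suc.IH[of "deriv f"] by auto
qed auto

lemma times_diff_const: "times_diff n S (\<lambda>x. c)"
proof (induction n arbitrary: c)
  case (Suc n)
  then show ?case by (auto intro!: exI[of _ "\<lambda>x. 0"])
qed auto

lemma times_diff_add:
  "times_diff n S f \<Longrightarrow> times_diff n S g \<Longrightarrow> times_diff n S (\<lambda>x. f x + g x)"
proof (induction n arbitrary: f g)
  case (Suc n)
  then obtain f' g' where "\<forall>x\<in>S. (f has_real_derivative f' x) (at x)" "times_diff n S f'"
    "\<forall>x\<in>S. (g has_real_derivative g' x) (at x)" "times_diff n S g'" by auto
  then have "\<forall>x\<in>S. ((\<lambda>x. f x + g x) has_real_derivative f' x + g' x) (at x)"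
    "times_diff n S (\<lambda>x. f' x + g' x)"
    using Suc.IH[of f' g'] by (auto intro: DERIV_add)
  then show ?case by (rule times_diff_SucI)
qed auto

lemma times_diff_mult:
  "times_diff n S f \<Longrightarrow> times_diff n S g \<Longrightarrow> times_diff n S (\<lambda>x. f x * g x)"
proof (induction n arbitrary: f g)
  case (Suc n)
  then obtain f' g' where d: "\<forall>x\<in>S. (f has_real_derivative f' x) (at x)" "times_diff n S f'"
    "\<forall>x\<in>S. (g has_real_derivative g' x) (at x)" "times_diff n S g'" by auto
  have "times_diff n S (\<lambda>x. f' x * g x + f x * g' x)"
    using d Suc.prems[THEN times_diff_mono] by (intro times_diff_add Suc.IH)
  then show ?case
  proof (rule times_diff_SucI[rotated])
    show "\<forall>x\<in>S. ((\<lambda>x. f x * g x) has_real_derivative f' x * g x + f x * g' x) (at x)"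
      using d DERIV_mult by (fastforce simp: algebra_simps)
  qed
qed auto

lemma times_diff_compose:
  "times_diff n T f \<Longrightarrow> times_diff n S g \<Longrightarrow> g ` S \<subseteq> T \<Longrightarrow> times_diff n S (\<lambda>x. f (g x))"
proof (induction n arbitrary: f)
  case (Suc n)
  then obtain f' g' where d: "\<forall>x\<in>T. (f has_real_derivative f' x) (at x)" "times_diff n T f'"
    "\<forall>x\<in>S. (g has_real_derivative g' x) (at x)" "times_diff n S g'" by auto
  have "times_diff n S (\<lambda>x. f' (g x) * g' x)"
    by (rule times_diff_mult[OF Suc.IH[OF d(2) times_diff_mono[OF Suc.prems(2)] Suc.prems(3)] d(4)])
  moreover have "\<forall>x\<in>S. ((\<lambda>x. f (g x)) has_real_derivative f' (g x) * g' x) (at x)"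
    using d Suc.prems(3) DERIV_chain2 by (metis image_subset_iff)
  ultimately show ?case by auto
qed auto

lemma smooth_cong: "open S \<Longrightarrow> smooth S f \<Longrightarrow> (\<And>x. x \<in> S \<Longrightarrow> f x = g x) \<Longrightarrow> smooth S g"
  unfolding smooth_def using times_diff_cong by blast

lemma smooth_subset: "smooth T f \<Longrightarrow> S \<subseteq> T \<Longrightarrow> smooth S f"
  unfolding smooth_def using times_diff_subset by blast

lemma smooth_Union: "(\<And>S. S \<in> \<F> \<Longrightarrow> open S \<and> smooth S f) \<Longrightarrow> smooth (\<Union>\<F>) f"
  unfolding smooth_def using times_diff_Union by blast

lemma smooth_Un: "open S \<Longrightarrow> open T \<Longrightarrow> smooth S f \<Longrightarrow> smooth T f \<Longrightarrow> smooth (S \<union> T) f"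
  using smooth_Union[of "{S, T}" f] by auto

lemma smooth_const: "smooth S (\<lambda>x. c)"
  unfolding smooth_def using times_diff_const by blast

lemma smooth_deriv_intro:
  assumes "\<And>x. x \<in> S \<Longrightarrow> (f has_real_derivative f' x) (at x)" "smooth S f'"
  shows "smooth S f"
proof -
  have "times_diff n S f" for n
    using assms by (cases n) (auto simp: smooth_def)
  then show ?thesis by (simp add: smooth_def)
qed

lemma smooth_ident: "smooth S (\<lambda>x. x)"
  by (rule smooth_deriv_intro[where f' = "\<lambda>x. 1"]) (auto intro: smooth_const)

lemma smooth_add: "smooth S f \<Longrightarrow> smooth S g \<Longrightarrow> smooth S (\<lambda>x. f x + g x)"
  unfolding smooth_def using times_diff_add by blast

lemma smooth_mult: "smooth S f \<Longrightarrow> smooth S g \<Longrightarrow> smooth S (\<lambda>x. f x * g x)"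
  unfolding smooth_def using times_diff_mult by blast

lemma smooth_compose: "smooth T f \<Longrightarrow> smooth S g \<Longrightarrow> g ` S \<subseteq> T \<Longrightarrow> smooth S (\<lambda>x. f (g x))"
  unfolding smooth_def using times_diff_compose by blast

lemma smooth_minus: "smooth S f \<Longrightarrow> smooth S (\<lambda>x. - f x)"
  using smooth_mult[OF smooth_const[of S "-1"]] by simp

lemma smooth_diff: "smooth S f \<Longrightarrow> smooth S g \<Longrightarrow> smooth S (\<lambda>x. f x - g x)"
  using smooth_add[OF _ smooth_minus] by fastforce

lemma smooth_power: "smooth S f \<Longrightarrow> smooth S (\<lambda>x. f x ^ n)"
  by (induction n) (auto intro: smooth_const smooth_mult)

lemma smooth_sum: "(\<And>i. i \<in> I \<Longrightarrow> smooth S (f i)) \<Longrightarrow> smooth S (\<lambda>x. \<Sum>i\<in>I. f i x)"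
  by (induction I rule: infinite_finite_induct) (auto intro: smooth_const smooth_add)

text \<open>The witness in \<open>times_diff\<close> may depend on the order; uniqueness of
  derivatives identifies all witnesses with \<open>deriv f\<close> on \<open>S\<close>.\<close>

lemma smooth_has_derivative:
  assumes "smooth S f" "open S"
  obtains f' where "\<And>x. x \<in> S \<Longrightarrow> (f has_real_derivative f' x) (at x)" "smooth S f'"
proof -
  have *: "\<exists>f'. (\<forall>x\<in>S. (f has_real_derivative f' x) (at x)) \<and> times_diff n S f'" for n
    using assms(1) times_diff.simps(2)[of n S f] unfolding smooth_def by blast
  then have d: "(f has_real_derivative deriv f x) (at x)" if "x \<in> S" for x
    using that *[of 0] DERIV_imp_deriv by fastforce
  have "times_diff n S (deriv f)" for n
  proof -
    obtain f' where f': "\<forall>x\<in>S. (f has_real_derivative f' x) (at x)" "times_diff n S f'"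
      using * by blast
    then show ?thesis
      by (intro times_diff_cong[OF assms(2) f'(2)]) (use f'(1) in \<open>auto simp: DERIV_imp_deriv\<close>)
  qed
  then show ?thesis using that d unfolding smooth_def by blast
qed

lemma smooth_imp_continuous_on: "smooth S f \<Longrightarrow> continuous_on S f"
  using times_diff.simps(2)[of 0 S f] DERIV_isCont
  unfolding smooth_def by (blast intro: continuous_at_imp_continuous_on)

text \<open>The family \<open>c * x powr r\<close> is closed under differentiation. Inverses and
  cube roots then come from the exponents -1 and 1/3.\<close>

lemma smooth_powr: "smooth {0<..} (\<lambda>x. x powr r)"
proof -
  have "times_diff n {0<..} (\<lambda>x. c * x powr r)" for n c
  proof (induction n arbitrary: r c)
    case (Suc n)
    have "\<forall>x\<in>{0<..}. ((\<lambda>x. c * x powr r) has_real_derivative (c * r) * x powr (r - 1)) (at x)"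
      by (auto intro!: derivative_eq_intros)
    then show ?case using Suc[of "c * r" "r - 1"] by auto
  qed auto
  from this[of _ 1] show ?thesis by (auto simp: smooth_def)
qed

lemma smooth_powr_compose:
  "smooth S f \<Longrightarrow> (\<And>x. x \<in> S \<Longrightarrow> f x > 0) \<Longrightarrow> smooth S (\<lambda>x. f x powr r)"
  by (rule smooth_compose[OF smooth_powr]) auto

lemma smooth_inverse:
  assumes "open S" "smooth S f" "\<And>x. x \<in> S \<Longrightarrow> f x > 0"
  shows "smooth S (\<lambda>x. inverse (f x))"
  by (rule smooth_cong[OF assms(1) smooth_powr_compose[OF assms(2,3), where r = "-1"]])
     (auto simp: powr_minus assms(3) abs_of_pos less_imp_le dest: assms(3))

lemma smooth_root3_pos:
  assumes "open S" "smooth S f" "\<And>x. x \<in> S \<Longrightarrow> f x > 0"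
  shows "smooth S (\<lambda>x. root 3 (f x))"
  by (rule smooth_cong[OF assms(1) smooth_powr_compose[OF assms(2,3), where r = "1/3"]])
     (auto simp: root_powr_inverse dest: assms(3))

lemma smooth_root3_neg:
  assumes "open S" "smooth S f" "\<And>x. x \<in> S \<Longrightarrow> f x < 0"
  shows "smooth S (\<lambda>x. root 3 (f x))"
  using smooth_minus[OF smooth_root3_pos[OF assms(1) smooth_minus[OF assms(2)]]] assms(3)
  by (simp add: real_root_minus)

section \<open>Passage to \<open>C_infinity\<close> and even extensions\<close>

lemma smooth_UNIV_imp_C_infinity:
  assumes "smooth UNIV f"
  shows "f \<in> C_infinity"
proof -
  have "smooth UNIV ((deriv ^^ n) f)" for n
  proof (induction n)
    case (Suc n)
    then obtain g where g: "\<And>x. ((deriv ^^ n) f has_real_derivative g x) (at x)" "smooth UNIV g"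
      using smooth_has_derivative[OF _ open_UNIV] by (metis UNIV_I)
    then have "deriv ((deriv ^^ n) f) = g" by (metis DERIV_imp_deriv ext)
    with g show ?case by simp
  qed (use assms in auto)
  then have "(deriv ^^ n) f differentiable (at x)" for n x
    by (meson UNIV_I open_UNIV real_differentiable_def smooth_has_derivative)
  then show ?thesis by (simp add: C_infinity_def)
qed

lemma smooth_poly: "smooth S f \<Longrightarrow> smooth S (\<lambda>x. poly p (f x))"
  unfolding poly_altdef by (intro smooth_sum smooth_mult smooth_const smooth_power)

text \<open>Away from 0 the absolute value is smooth; near 0 a polynomial in
  \<open>z\<^sup>2\<close> does not see the sign of \<open>z\<close>.\<close>

lemma smooth_even_extension:
  assumes f: "smooth {0<..} f" and e: "e > 0"
    and poly: "\<And>z. 0 \<le> z \<Longrightarrow> z < e \<Longrightarrow> f z = poly p (z\<^sup>2)"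
  shows "smooth UNIV (\<lambda>z. f \<bar>z\<bar>)"
proof -
  have 1: "smooth {0<..} (\<lambda>z. f \<bar>z\<bar>)"
    by (rule smooth_cong[OF _ f]) auto
  have 2: "smooth {..<0} (\<lambda>z. f \<bar>z\<bar>)"
    by (rule smooth_cong[OF _ smooth_compose[OF f smooth_minus[OF smooth_ident]]]) auto
  have 3: "smooth {-e<..<e} (\<lambda>z. f \<bar>z\<bar>)"
  proof (rule smooth_cong)
    show "smooth {-e<..<e} (\<lambda>z. poly p (z\<^sup>2))"
      by (intro smooth_poly smooth_power smooth_ident)
    show "poly p (z\<^sup>2) = f \<bar>z\<bar>" if "z \<in> {-e<..<e}" for z
      using poly[of "\<bar>z\<bar>"] that by (auto simp: abs_less_iff)
  qed auto
  have "smooth ({0<..} \<union> {..<0} \<union> {-e<..<e}) (\<lambda>z. f \<bar>z\<bar>)"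
    using 1 2 3 by (intro smooth_Un) auto
  moreover have "{0<..} \<union> {..<0} \<union> {-e<..<e} = (UNIV :: real set)"
    using e by auto
  ultimately show ?thesis by simp
qed

subsection \<open>Flat functions, steps and bumps\<close>

text \<open>The extra power makes the family closed under differentiation (up to linear
  combinations), multiplication by the argument and cube roots. On (-1,1),
  \<open>flat 1 0 (1 - z\<^sup>2)\<close> is the profile prescribed for \<open>A\<close> near
  1.\<close>

definition flat :: "real \<Rightarrow> real \<Rightarrow> real \<Rightarrow> real" where
  "flat c r x = (if x > 0 then exp (- c / x) * x powr r else 0)"

lemma flat_pos: "x > 0 \<Longrightarrow> flat c r x > 0"
  by (simp add: flat_def)

lemma flat_nonneg: "flat c r x \<ge> 0"
  by (simp add: flat_def)

lemma flat_eq_0: "x \<le> 0 \<Longrightarrow> flat c r x = 0"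
  by (simp add: flat_def)

lemma flat_mult_ident: "flat c r x * x = flat c (r + 1) x"
  by (simp add: flat_def powr_add)

lemma root3_flat: "root 3 (flat c r x) = flat (c / 3) (r / 3) x"
proof (cases "x > 0")
  case True
  have "flat (c / 3) (r / 3) x ^ 3 = flat c r x"
    using True exp_of_nat_mult[of 3 "- (c / 3) / x"] powr_power[where z = x and n = 3 and u = "r / 3"]
    by (simp add: flat_def power_mult_distrib)
  then show ?thesis
    using flat_nonneg real_root_power_cancel[of 3 "flat (c / 3) (r / 3) x"] by simp
qed (simp add: flat_def)

lemma tendsto_flat_0:
  assumes "c > 0"
  shows "(flat c r \<longlongrightarrow> 0) (at 0)"
proof -
  \<comment> \<open>For \<open>x < 1\<close> the factor \<open>x powr r\<close> is then at most
    \<open>1 / x ^ n\<close>, so the function is dominated by a multiple of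
    \<open>(c / x) ^ n / exp (c / x)\<close>.\<close>
  obtain n :: nat where n: "- r \<le> real n" using real_arch_simple by blast
  have "filterlim (\<lambda>x::real. c / x) at_top (at_right 0)"
    using assms by (auto simp: divide_inverse intro!: filterlim_tendsto_pos_mult_at_top filterlim_inverse_at_top_right)
  then have "((\<lambda>x. (c / x) ^ n / exp (c / x)) \<longlongrightarrow> 0) (at_right 0)"
    by (rule filterlim_compose[OF tendsto_power_div_exp_0])
  then have lim: "((\<lambda>x. inverse (c ^ n) * ((c / x) ^ n / exp (c / x))) \<longlongrightarrow> 0) (at_right 0)"
    by (rule tendsto_mult_right_zero)
  have le: "flat c r x \<le> inverse (c ^ n) * ((c / x) ^ n / exp (c / x))" if x: "x > 0" "x < 1" for x
  proof -
    have "x powr r \<le> x powr (- real n)"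
      using x n by (intro powr_mono') auto
    also have "\<dots> = inverse (x ^ n)"
      using x by (simp add: powr_minus powr_realpow)
    finally show ?thesis
      using x assms by (simp add: flat_def exp_minus field_simps)
  qed
  have "(flat c r \<longlongrightarrow> 0) (at_right 0)"
  proof (rule tendsto_sandwich[OF _ _ tendsto_const lim])
    show "\<forall>\<^sub>F x in at_right 0. flat c r x \<le> inverse (c ^ n) * ((c / x) ^ n / exp (c / x))"
      unfolding eventually_at_right_field by (rule exI[of _ 1]) (use le in auto)
  qed (simp add: flat_nonneg)
  moreover have "(flat c r \<longlongrightarrow> 0) (at_left 0)"
    by (rule tendsto_eventually) (auto simp: eventually_at_left_field flat_eq_0 intro!: exI[of _ "-1"])
  ultimately show ?thesis by (simp add: filterlim_split_at)
qed

lemma flat_has_real_derivative: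
  assumes "c > 0"
  shows "(flat c r has_real_derivative c * flat c (r - 2) x + r * flat c (r - 1) x) (at x)"
proof (cases x "0 :: real" rule: linorder_cases)
  case less
  show ?thesis
  proof (rule has_field_derivative_transform_within_open[where S = "{..<0}"])
    show "((\<lambda>x. 0) has_real_derivative c * flat c (r - 2) x + r * flat c (r - 1) x) (at x)"
      using less by (simp add: flat_def)
  qed (use less in \<open>auto simp: flat_def\<close>)
next
  case equal
  \<comment> \<open>At 0 the difference quotient is itself a flat function with exponent lowered by
    1.\<close>
  have "(\<lambda>h. (flat c r (0 + h) - flat c r 0) / h) = flat c (r - 1)"
    by (auto simp: flat_def powr_diff)
  then show ?thesis
    using equal tendsto_flat_0[OF assms, of "r - 1"] by (simp add: DERIV_def flat_eq_0)
next
  case greater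
  show ?thesis
  proof (rule has_field_derivative_transform_within_open[where S = "{0<..}"])
    show "((\<lambda>x. exp (- c / x) * x powr r) has_real_derivative c * flat c (r - 2) x + r * flat c (r - 1) x) (at x)"
    proof -
      have "x powr (r - 2) = x powr r / x\<^sup>2"
        using greater by (simp add: powr_diff)
      moreover have "((\<lambda>x. exp (- c / x)) has_real_derivative exp (- c / x) * (c / x\<^sup>2)) (at x)"
        by (rule DERIV_fun_exp) (use greater in \<open>auto intro!: derivative_eq_intros simp: power2_eq_square\<close>)
      moreover have "((\<lambda>x. x powr r) has_real_derivative r * x powr (r - 1)) (at x)"
        using greater by (rule has_real_derivative_powr)
      ultimately show ?thesis
        using DERIV_mult[of "\<lambda>x. exp (- c / x)" "exp (- c / x) * (c / x\<^sup>2)" x UNIV "\<lambda>x. x powr r" "r * x powr (r - 1)"] greater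
        by (simp add: flat_def mult_ac)
    qed
  qed (use greater in \<open>auto simp: flat_def\<close>)
qed

lemma smooth_flat:
  assumes "c > 0"
  shows "smooth S (flat c r)"
proof -
  have "times_diff n S (\<lambda>x. flat c r x)" for n r
  proof (induction n arbitrary: r)
    case (Suc n)
    have "times_diff n S (\<lambda>x. c * flat c (r - 2) x + r * flat c (r - 1) x)"
      by (intro times_diff_add times_diff_mult times_diff_const Suc.IH)
    then show ?case by (intro times_diff_SucI) (use flat_has_real_derivative[OF assms] in auto)
  qed auto
  then show ?thesis by (simp add: smooth_def)
qed

text \<open>With \<open>x = 1 - z\<^sup>2\<close>, each differentiation of the exponential brings
  down \<open>- 2 * c * z / x\<^sup>2\<close>. Two of them cost four powers of \<open>x\<close> and
  leave \<open>4 * c\<^sup>2 * z\<^sup>2\<close>; relative to this all other terms carry a positive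
  power of \<open>x\<close> and go into the smooth factor \<open>l\<close>. Hence \<open>l 1\<close>
  inherits the sign of \<open>k 1\<close>.\<close>

lemma flat_laplacian:
  fixes k :: "real \<Rightarrow> real" and N :: nat and c r e :: real
  assumes c: "c > 0" and e: "e \<le> 1" and k: "smooth {1-e<..<1+e} k"
  defines "u \<equiv> \<lambda>z. flat c r (1 - z\<^sup>2) * k z"
  obtains u' u'' l where
    "smooth {1-e<..<1+e} l" "l 1 = 4 * c\<^sup>2 * k 1"
    "\<And>z. z \<in> {1-e<..<1+e} \<Longrightarrow> (u has_real_derivative u' z) (at z)"
    "\<And>z. z \<in> {1-e<..<1+e} \<Longrightarrow> (u' has_real_derivative u'' z) (at z)"
    "\<And>z. z \<in> {1-e<..<1+e} \<Longrightarrow> u'' z + (real N - 1) / z * u' z = flat c (r - 4) (1 - z\<^sup>2) * l z"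
    "\<And>z. z \<ge> 1 \<Longrightarrow> u' z = 0"
proof -
  let ?I = "{1-e<..<1+e}"
  obtain k' where k': "\<And>z. z \<in> ?I \<Longrightarrow> (k has_real_derivative k' z) (at z)" "smooth ?I k'"
    using smooth_has_derivative[OF k] by auto
  obtain k'' where k'': "\<And>z. z \<in> ?I \<Longrightarrow> (k' has_real_derivative k'' z) (at z)" "smooth ?I k''"
    using smooth_has_derivative[OF k'(2)] by auto
  define F where "F = (\<lambda>j z. flat c (r - j) (1 - z\<^sup>2))"
  have F_mult: "F j z = F (j + 1) z * (1 - z\<^sup>2)" for j z
    using flat_mult_ident[of c "r - (j + 1)" "1 - z\<^sup>2"] by (simp add: F_def)
  have F': "(F j has_real_derivative - 2 * z * (c * F (j + 2) z + (r - j) * F (j + 1) z)) (at z)" for j z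
  proof -
    have "((\<lambda>z::real. 1 - z\<^sup>2) has_real_derivative - 2 * z) (at z)"
      by (auto intro!: derivative_eq_intros)
    from DERIV_chain2[OF flat_has_real_derivative[OF c, of "r - j"] this] show ?thesis
      by (simp add: F_def algebra_simps)
  qed
  define u' where "u' = (\<lambda>z. - 2 * z * (c * F 2 z + r * F 1 z) * k z + F 0 z * k' z)"
  define u'' where "u'' = (\<lambda>z.
     (4 * z\<^sup>2 * (c * (c * F 4 z + (r - 2) * F 3 z) + r * (c * F 3 z + (r - 1) * F 2 z))
        - 2 * (c * F 2 z + r * F 1 z)) * k z
     - 4 * z * (c * F 2 z + r * F 1 z) * k' z + F 0 z * k'' z)"
  \<comment> \<open>After factoring out \<open>F 4\<close>, \<open>p0\<close> is what remains of
    \<open>c * F 2 + r * F 1\<close>, and \<open>p1\<close> of the bracket multiplied by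
    \<open>4 * z\<^sup>2\<close> in \<open>u''\<close>.\<close>
  define p0 where "p0 = (\<lambda>z::real. c * (1 - z\<^sup>2)\<^sup>2 + r * (1 - z\<^sup>2) ^ 3)"
  define p1 where "p1 = (\<lambda>z::real. c\<^sup>2 + (2 * r - 2) * c * (1 - z\<^sup>2) + r * (r - 1) * (1 - z\<^sup>2)\<^sup>2)"
  define l where "l = (\<lambda>z. 4 * z\<^sup>2 * p1 z * k z - 2 * p0 z * k z - 4 * z * p0 z * k' z + (1 - z\<^sup>2) ^ 4 * k'' z
     + (real N - 1) * inverse z * (- 2 * z * p0 z * k z + (1 - z\<^sup>2) ^ 4 * k' z))"
  show thesis
  proof (rule that[of l u' u''])
    show "smooth ?I l"
      unfolding l_def p0_def p1_def
      using e by (intro smooth_add smooth_diff smooth_mult smooth_const smooth_ident smooth_power k k'(2) k''(2)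
        smooth_inverse) auto
    show "l 1 = 4 * c\<^sup>2 * k 1" by (simp add: l_def p0_def p1_def)
    show "(u has_real_derivative u' z) (at z)" if "z \<in> ?I" for z
    proof -
      have "u = (\<lambda>z. F 0 z * k z)" by (simp add: u_def F_def)
      then show ?thesis
        using DERIV_mult[OF F'[of 0 z] k'(1)[OF that]] by (simp add: u'_def algebra_simps)
    qed
    show "(u' has_real_derivative u'' z) (at z)" if "z \<in> ?I" for z
      unfolding u'_def u''_def
      by (rule derivative_eq_intros F' k'(1)[OF that] k''(1)[OF that] refl)+
         (simp add: algebra_simps power2_eq_square)
    show "u'' z + (real N - 1) / z * u' z = flat c (r - 4) (1 - z\<^sup>2) * l z" if "z \<in> ?I" for z
    proof -
      have z: "z \<noteq> 0" using that e by auto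
      define x where "x = 1 - z\<^sup>2"
      have eq: "F 3 z = F 4 z * x" "F 2 z = F 4 z * x ^ 2" "F 1 z = F 4 z * x ^ 3" "F 0 z = F 4 z * x ^ 4"
        using F_mult[of 3 z] F_mult[of 2 z] F_mult[of 1 z] F_mult[of 0 z]
        by (simp_all add: x_def power_numeral_reduce)
      have a: "u' z = F 4 z * (- 2 * z * p0 z * k z + x ^ 4 * k' z)"
        unfolding u'_def eq p0_def x_def[symmetric] by (simp add: algebra_simps)
      have b: "u'' z = F 4 z * (4 * z\<^sup>2 * p1 z * k z - 2 * p0 z * k z - 4 * z * p0 z * k' z + x ^ 4 * k'' z)"
        unfolding u''_def eq p0_def p1_def x_def[symmetric] by (simp add: algebra_simps power2_eq_square power3_eq_cube)
      have "flat c (r - 4) (1 - z\<^sup>2) = F 4 z" by (simp add: F_def)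
      then show ?thesis
        unfolding a b l_def x_def[symmetric] by (simp add: algebra_simps divide_inverse)
    qed
    show "u' z = 0" if "z \<ge> 1" for z
    proof -
      have "1 - z\<^sup>2 \<le> 0" using that by simp
      then show ?thesis by (simp add: u'_def F_def flat_eq_0)
    qed
  qed
qed

section \<open>Smooth steps and bumps\<close>

definition step :: "real \<Rightarrow> real" where
  "step x = flat 1 0 x * inverse (flat 1 0 x + flat 1 0 (1 - x))"

text \<open>The arguments \<open>x\<close> and \<open>1 - x\<close> cannot both be
  nonpositive.\<close>

lemma step_denom_pos: "flat 1 0 x + flat 1 0 (1 - x) > 0"
  by (cases "x > 0") (auto intro: add_pos_nonneg add_nonneg_pos simp: flat_pos flat_nonneg)

lemma smooth_step: "smooth UNIV step"
  unfolding step_def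
  by (intro smooth_mult smooth_inverse smooth_add smooth_flat smooth_compose[OF smooth_flat[of 1 UNIV]]
      smooth_diff smooth_const smooth_ident) (auto simp: step_denom_pos)

lemma step_eq_0: "x \<le> 0 \<Longrightarrow> step x = 0"
  by (simp add: step_def flat_eq_0)

lemma step_eq_1: "x \<ge> 1 \<Longrightarrow> step x = 1"
  using step_denom_pos[of x] by (simp add: step_def flat_eq_0)

lemma step_bounds: "0 \<le> step x" "step x \<le> 1"
  using step_denom_pos[of x] flat_nonneg[of 1 0 x] flat_nonneg[of 1 0 "1 - x"]
  by (auto simp: step_def field_simps)

definition bump :: "real \<Rightarrow> real \<Rightarrow> real \<Rightarrow> real" where
  "bump l r x = flat 1 0 (x - l) * flat 1 0 (r - x)"

lemma smooth_bump: "smooth UNIV (bump l r)"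
  unfolding bump_def
  by (intro smooth_mult smooth_compose[OF smooth_flat[of 1 UNIV]] smooth_diff smooth_const smooth_ident) auto

lemma bump_nonneg: "bump l r x \<ge> 0"
  by (simp add: bump_def flat_nonneg)

lemma bump_pos: "l < x \<Longrightarrow> x < r \<Longrightarrow> bump l r x > 0"
  by (simp add: bump_def flat_pos)

lemma bump_eq_0: "x \<le> l \<or> x \<ge> r \<Longrightarrow> bump l r x = 0"
  by (auto simp: bump_def flat_eq_0)

subsection \<open>The radial Laplace equation\<close>

definition flux :: "nat \<Rightarrow> (real \<Rightarrow> real) \<Rightarrow> real \<Rightarrow> real" where
  "flux m f z = integral {0..z} (\<lambda>y. y ^ m * f y)"

text \<open>
  The upper limit 2 (instead of 1) makes \<open>pot m f\<close> differentiable at 1. At \<open>y = 0\<close> the integrand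
  has the junk value 0, which is also its limit for the functions \<open>f\<close> considered.
\<close>

definition pot :: "nat \<Rightarrow> (real \<Rightarrow> real) \<Rightarrow> real \<Rightarrow> real" where
  "pot m f z = integral {z..2} (\<lambda>y. flux m f y / y ^ m)"

text \<open>Being a polynomial in \<open>z\<^sup>2\<close> near 0 is preserved by \<open>pot\<close> and makes \<open>\<lambda>z. f \<bar>z\<bar>\<close> smooth at 0.\<close>

definition regular :: "(real \<Rightarrow> real) \<Rightarrow> bool" where
  "regular f \<longleftrightarrow> continuous_on {0..} f \<and> (\<exists>e>0. \<exists>p. \<forall>z. 0 \<le> z \<and> z < e \<longrightarrow> f z = poly p (z\<^sup>2))"

lemma regularI:
  "continuous_on {0..} f \<Longrightarrow> e > 0 \<Longrightarrow> (\<And>z. 0 \<le> z \<Longrightarrow> z < e \<Longrightarrow> f z = poly p (z\<^sup>2)) \<Longrightarrow> regular f"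
  unfolding regular_def by blast

lemma regularE:
  assumes "regular f"
  obtains e p where "e > 0" "\<And>z. 0 \<le> z \<Longrightarrow> z < e \<Longrightarrow> f z = poly p (z\<^sup>2)"
  using assms unfolding regular_def by blast

lemma regular_continuous: "regular f \<Longrightarrow> continuous_on {0..} f"
  by (simp add: regular_def)

lemma regular_add:
  assumes "regular f" "regular g"
  shows "regular (\<lambda>z. f z + g z)"
proof -
  obtain d p where p: "d > 0" "\<And>z. 0 \<le> z \<Longrightarrow> z < d \<Longrightarrow> f z = poly p (z\<^sup>2)"
    using assms(1) by (rule regularE) blast
  obtain e q where q: "e > 0" "\<And>z. 0 \<le> z \<Longrightarrow> z < e \<Longrightarrow> g z = poly q (z\<^sup>2)"
    using assms(2) by (rule regularE) blast
  show ?thesis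
    using p q assms[THEN regular_continuous]
    by (intro regularI[where e = "min d e" and p = "p + q"] continuous_on_add) auto
qed

lemma regular_mult:
  assumes "regular f" "regular g"
  shows "regular (\<lambda>z. f z * g z)"
proof -
  obtain d p where p: "d > 0" "\<And>z. 0 \<le> z \<Longrightarrow> z < d \<Longrightarrow> f z = poly p (z\<^sup>2)"
    using assms(1) by (rule regularE) blast
  obtain e q where q: "e > 0" "\<And>z. 0 \<le> z \<Longrightarrow> z < e \<Longrightarrow> g z = poly q (z\<^sup>2)"
    using assms(2) by (rule regularE) blast
  show ?thesis
    using p q assms[THEN regular_continuous]
    by (intro regularI[where e = "min d e" and p = "p * q"] continuous_on_mult) auto
qed

lemma regular_const: "regular (\<lambda>z. c)"
  by (rule regularI[where e = 1 and p = "[:c:]"]) auto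

lemma regular_cmult: "regular f \<Longrightarrow> regular (\<lambda>z. c * f z)"
  by (intro regular_mult regular_const)

lemma regular_power: "regular f \<Longrightarrow> regular (\<lambda>z. f z ^ n)"
  by (induction n) (auto intro: regular_const regular_mult)

lemma regular_smooth:
  assumes "smooth UNIV f" "e > 0" "\<And>z. 0 \<le> z \<Longrightarrow> z < e \<Longrightarrow> f z = c"
  shows "regular f"
  using assms
  by (intro regularI[where e = e and p = "[:c:]"] continuous_on_subset[OF smooth_imp_continuous_on[OF assms(1)]]) auto

lemma flux_integrand_continuous:
  "regular f \<Longrightarrow> continuous_on {0..z} (\<lambda>y. y ^ m * f y)"
  by (intro continuous_intros continuous_on_subset[OF regular_continuous]) auto

lemma flux_0: "flux m f 0 = 0"
  by (simp add: flux_def)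

lemma flux_has_derivative_within:
  assumes "regular f" "0 \<le> z" "z \<le> b"
  shows "(flux m f has_real_derivative z ^ m * f z) (at z within {0..b})"
  unfolding flux_def
  using integral_has_real_derivative[OF flux_integrand_continuous[OF assms(1)]] assms(2,3) by auto

lemma flux_has_derivative:
  assumes "regular f" "0 < z"
  shows "(flux m f has_real_derivative z ^ m * f z) (at z)"
  using flux_has_derivative_within[OF assms(1), of z "z + 1" m] assms(2)
  by (simp add: at_within_interior[of z "{0..z + 1}"])

lemma flux_continuous:
  assumes "regular f"
  shows "continuous_on {0..} (flux m f)"
proof -
  have "continuous (at z within {0..}) (flux m f)" if "z \<ge> 0" for z
  proof -
    have "continuous (at z within {0..z + 1}) (flux m f)"
      using flux_has_derivative_within[OF assms, of z "z + 1" m] that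
      by (auto intro: has_field_derivative_imp_has_derivative has_derivative_continuous)
    moreover have "at z within {0..z + 1} = at z within {0..}"
      by (rule at_within_nhd[of _ "{..<z + 1}"]) auto
    ultimately show ?thesis by simp
  qed
  then show ?thesis by (simp add: continuous_on_eq_continuous_within)
qed

lemma has_derivative_zero_interval_constant:
  fixes f :: "real \<Rightarrow> real"
  assumes "continuous_on {a..b} f" "\<And>z. a < z \<Longrightarrow> z < b \<Longrightarrow> (f has_real_derivative 0) (at z)"
    and "x \<in> {a..b}" "y \<in> {a..b}"
  shows "f x = f y"
proof -
  have "f u = f a" if "u \<in> {a..b}" for u
    using that DERIV_isconst2[of a b f u] assms(1,2) by (cases "a = b") auto
  then show ?thesis using assms(3,4) by metis
qed

text \<open>Integrating the polynomial germ termwise, the factor \<open>z ^ m\<close> cancels and an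
  odd polynomial remains. It is 0 at the origin, in agreement with the value of the quotient
  there.\<close>

lemma pot_ratio_near_0:
  assumes "e > 0" and reg: "regular f" and "\<And>z. 0 \<le> z \<Longrightarrow> z < e \<Longrightarrow> f z = poly p (z\<^sup>2)"
    and z: "0 \<le> z" "z < e"
  shows "flux m f z / z ^ m = (\<Sum>k\<le>degree p. coeff p k / real (m + 1 + 2 * k) * z ^ (2 * k + 1))"
proof -
  define g where "g = (\<lambda>z::real. \<Sum>k\<le>degree p. coeff p k / real (m + 1 + 2 * k) * z ^ (m + 1 + 2 * k))"
  have g0: "g 0 = 0" by (simp add: g_def)
  have "(g has_real_derivative y ^ m * poly p (y\<^sup>2)) (at y)" for y
  proof -
    have "(g has_real_derivative (\<Sum>k\<le>degree p. coeff p k / real (m + 1 + 2 * k) *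
         (real (m + 1 + 2 * k) * y ^ (m + 1 + 2 * k - 1)))) (at y)"
      unfolding g_def by (intro DERIV_sum DERIV_cmult DERIV_pow[THEN DERIV_cong]) simp
    also have "(\<Sum>k\<le>degree p. coeff p k / real (m + 1 + 2 * k) *
         (real (m + 1 + 2 * k) * y ^ (m + 1 + 2 * k - 1))) = y ^ m * poly p (y\<^sup>2)"
      unfolding poly_altdef sum_distrib_left
    proof (rule sum.cong[OF refl])
      fix k
      have "real (m + 1 + 2 * k) \<noteq> 0" by linarith
      then show "coeff p k / real (m + 1 + 2 * k) * (real (m + 1 + 2 * k) * y ^ (m + 1 + 2 * k - 1))
          = y ^ m * (coeff p k * (y\<^sup>2) ^ k)"
        by (simp add: power_add power_mult)
    qed
    finally show ?thesis .
  qed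
  note g' = this
  have "flux m f z - g z = flux m f 0 - g 0"
  proof (rule has_derivative_zero_interval_constant[of 0 z "\<lambda>z. flux m f z - g z"])
    show "continuous_on {0..z} (\<lambda>z. flux m f z - g z)"
      by (intro continuous_intros continuous_on_subset[OF flux_continuous[OF reg]]
          continuous_at_imp_continuous_on ballI DERIV_isCont[OF g']) auto
    show "((\<lambda>z. flux m f z - g z) has_real_derivative 0) (at y)" if "0 < y" "y < z" for y
      using DERIV_diff[OF flux_has_derivative[OF reg that(1), of m] g'] assms(3)[of y] that z by auto
  qed (use z in auto)
  then have eq: "flux m f z = g z" using g0 flux_0 by simp
  show ?thesis
  proof (cases "z = 0")
    case False
    then show ?thesis unfolding eq g_def sum_divide_distrib
      by (intro sum.cong) (auto simp: power_add)
  qed (simp add: flux_0)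
qed

lemma pot_integrand_continuous:
  assumes "regular f"
  shows "continuous_on {0..} (\<lambda>y. flux m f y / y ^ m)"
proof -
  obtain e p where e: "e > 0" and p: "\<And>z. 0 \<le> z \<Longrightarrow> z < e \<Longrightarrow> f z = poly p (z\<^sup>2)"
    using assms by (rule regularE) blast
  have "continuous_on ({0..e / 2} \<union> {e / 2..}) (\<lambda>y. flux m f y / y ^ m)"
  proof (rule continuous_on_closed_Un)
    have "continuous_on {0..e / 2} (\<lambda>z. \<Sum>k\<le>degree p. coeff p k / real (m + 1 + 2 * k) * z ^ (2 * k + 1))"
      by (intro continuous_intros)
    then show "continuous_on {0..e / 2} (\<lambda>y. flux m f y / y ^ m)"
      by (rule continuous_on_eq) (use pot_ratio_near_0[OF e assms p] e in auto)
    show "continuous_on {e / 2..} (\<lambda>y. flux m f y / y ^ m)"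
      using e by (intro continuous_intros continuous_on_subset[OF flux_continuous[OF assms]]) auto
  qed auto
  moreover have "{0..e / 2} \<union> {e / 2..} = {0..}" using e by auto
  ultimately show ?thesis by simp
qed

lemma pot_has_derivative_within:
  assumes "regular f" "0 \<le> z" "z \<le> 2"
  shows "(pot m f has_real_derivative - (flux m f z / z ^ m)) (at z within {0..2})"
  unfolding pot_def
  using integral_has_real_derivative'[OF continuous_on_subset[OF pot_integrand_continuous[OF assms(1)]]] assms(2,3)
  by auto

lemma pot_has_derivative:
  assumes "regular f" "0 < z" "z < 2"
  shows "(pot m f has_real_derivative - (flux m f z / z ^ m)) (at z)"
  using pot_has_derivative_within[OF assms(1), of z m] assms(2,3)
  by (simp add: at_within_interior[of z "{0..2}"])

lemma pot_continuous:
  assumes "regular f"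
  shows "continuous_on {0..2} (pot m f)"
  using pot_has_derivative_within[OF assms]
  by (auto simp: continuous_on_eq_continuous_within
      intro!: has_field_derivative_imp_has_derivative[THEN has_derivative_continuous])

lemma flux_add:
  assumes "regular f" "regular g"
  shows "flux m (\<lambda>z. f z + g z) z = flux m f z + flux m g z"
  unfolding flux_def
  using assms[THEN flux_integrand_continuous, THEN integrable_continuous_real]
  by (subst integral_add[symmetric]) (auto simp: distrib_left)

lemma flux_cmult: "flux m (\<lambda>z. c * f z) z = c * flux m f z"
  unfolding flux_def by (subst integral_mult_right[symmetric]) (simp add: mult_ac)

lemma pot_add:
  assumes "regular f" "regular g" "0 \<le> z"
  shows "pot m (\<lambda>z. f z + g z) z = pot m f z + pot m g z"
proof -
  have "(\<lambda>y. flux m h y / y ^ m) integrable_on {z..2}" if "regular h" for h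
    by (intro integrable_continuous_real continuous_on_subset[OF pot_integrand_continuous[OF that]])
       (use assms in auto)
  then show ?thesis
    unfolding pot_def flux_add[OF assms(1,2)] add_divide_distrib
    using assms by (intro integral_add) auto
qed

lemma pot_cmult: "pot m (\<lambda>z. c * f z) z = c * pot m f z"
  unfolding pot_def flux_cmult by (subst integral_mult_right[symmetric]) simp

text \<open>The form \<open>m * z ^ m / z\<close> avoids the truncated exponent
  \<open>m - 1\<close>, so \<open>m = 0\<close> is covered.\<close>

lemma DERIV_power_quotient:
  fixes z :: real
  assumes "z \<noteq> 0"
  shows "((\<lambda>z. z ^ m) has_real_derivative real m * z ^ m / z) (at z)"
proof (cases m)
  case (Suc k)
  have "real m * z ^ (m - Suc 0) = real m * z ^ m / z"
    using assms Suc by simp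
  then show ?thesis using DERIV_pow[of m z UNIV] by simp
qed simp

text \<open>Beyond 1 the flux is constant, hence 0, and so is the potential: \<open>pot m f\<close>
  is carried by the unit interval and solves the equation on the whole half line.\<close>

locale balanced =
  fixes m :: nat and f :: "real \<Rightarrow> real"
  assumes reg: "regular f"
    and vanish: "\<And>z. z \<ge> 1 \<Longrightarrow> f z = 0"
    and flux_1: "flux m f 1 = 0"
begin

lemma flux_vanish: "z \<ge> 1 \<Longrightarrow> flux m f z = 0"
proof -
  assume z: "z \<ge> 1"
  have "flux m f z = flux m f 1"
  proof (rule has_derivative_zero_interval_constant[of 1 z "flux m f"])
    show "(flux m f has_real_derivative 0) (at y)" if "1 < y" "y < z" for y
      using flux_has_derivative[OF reg, of y m] vanish[of y] that by simp
  qed (use z in \<open>auto intro: continuous_on_subset[OF flux_continuous[OF reg]]\<close>)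
  then show ?thesis by (simp add: flux_1)
qed

lemma pot_vanish: "z \<ge> 1 \<Longrightarrow> pot m f z = 0"
  unfolding pot_def
  by (subst integral_cong[where g = "\<lambda>y. 0"]) (auto simp: flux_vanish)

lemma pot_deriv:
  assumes "z > 0"
  shows "(pot m f has_real_derivative - (flux m f z / z ^ m)) (at z)"
proof (cases "z < 2")
  case True
  then show ?thesis using pot_has_derivative[OF reg assms] by simp
next
  case False
  \<comment> \<open>From the integration limit 2 on, the derivative comes from the vanishing of the
    potential on \<open>{1<..}\<close> instead of from the integral.\<close>
  have "(pot m f has_real_derivative 0) (at z)"
    by (rule has_field_derivative_transform_within_open[where S = "{1<..}" and f = "\<lambda>x. 0"])
       (use False in \<open>auto simp: pot_vanish\<close>)
  then show ?thesis using False by (simp add: flux_vanish)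
qed

lemma flux_quotient_deriv:
  assumes "z > 0"
  shows "((\<lambda>z. flux m f z / z ^ m) has_real_derivative f z - real m / z * (flux m f z / z ^ m)) (at z)"
proof -
  have "((\<lambda>z. flux m f z / z ^ m) has_real_derivative
      (z ^ m * f z * z ^ m - flux m f z * (real m * z ^ m / z)) / (z ^ m * z ^ m)) (at z)"
    by (intro DERIV_divide flux_has_derivative reg DERIV_power_quotient) (use assms in auto)
  also have "(z ^ m * f z * z ^ m - flux m f z * (real m * z ^ m / z)) / (z ^ m * z ^ m)
      = f z - real m / z * (flux m f z / z ^ m)"
    using assms by (simp add: field_simps)
  finally show ?thesis .
qed

lemma pot_continuous: "continuous_on {0..} (pot m f)"
proof -
  have "continuous_on ({0..2} \<union> {1..}) (pot m f)"
  proof (rule continuous_on_closed_Un)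
    show "continuous_on {1..} (pot m f)"
      by (rule continuous_on_eq[where f = "\<lambda>z. 0"]) (auto simp: pot_vanish)
  qed (use Submission.pot_continuous[OF reg] in auto)
  moreover have "{0..2} \<union> {1..} = {0::real..}" by auto
  ultimately show ?thesis by simp
qed

text \<open>A second termwise integration turns the odd polynomial \<open>flux m f z / z ^ m\<close>
  into a polynomial in \<open>z\<^sup>2\<close>. This is what allows the passage from
  \<open>D\<close> to \<open>B\<close> to be repeated from \<open>B\<close> to
  \<open>A\<close>.\<close>

lemma regular_pot: "regular (pot m f)"
proof -
  obtain e p where e: "e > 0" and p: "\<And>z. 0 \<le> z \<Longrightarrow> z < e \<Longrightarrow> f z = poly p (z\<^sup>2)"
    using reg by (rule regularE) blast
  define q where "q = [:pot m f 0:] -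
    (\<Sum>k\<le>degree p. monom (coeff p k / real (m + 1 + 2 * k) / real (2 * k + 2)) (k + 1))"
  have q: "poly q (z\<^sup>2) = pot m f 0 -
      (\<Sum>k\<le>degree p. coeff p k / real (m + 1 + 2 * k) / real (2 * k + 2) * z ^ (2 * k + 2))" for z
  proof -
    have "(z\<^sup>2) ^ (k + 1) = z ^ (2 * k + 2)" for k
      by (simp only: power_mult[symmetric]) simp
    then show ?thesis by (simp only: q_def poly_diff poly_sum poly_monom) simp
  qed
  have q': "((\<lambda>z. poly q (z\<^sup>2)) has_real_derivative
      - (\<Sum>k\<le>degree p. coeff p k / real (m + 1 + 2 * k) * z ^ (2 * k + 1))) (at z)" for z
  proof -
    have "((\<lambda>z. poly q (z\<^sup>2)) has_real_derivative
      0 - (\<Sum>k\<le>degree p. coeff p k / real (m + 1 + 2 * k) / real (2 * k + 2) * (real (2 * k + 2) * z ^ (2 * k + 2 - 1)))) (at z)"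
      unfolding q by (intro DERIV_diff DERIV_const DERIV_sum DERIV_cmult DERIV_pow[THEN DERIV_cong]) simp
    moreover have "coeff p k / real (m + 1 + 2 * k) / real (2 * k + 2) * (real (2 * k + 2) * z ^ (2 * k + 2 - 1))
        = coeff p k / real (m + 1 + 2 * k) * z ^ (2 * k + 1)" for k
    proof -
      have "real (2 * k + 2) \<noteq> 0" by linarith
      then show ?thesis by (simp del: of_nat_add of_nat_mult)
    qed
    ultimately show ?thesis by simp
  qed
  have "pot m f z = poly q (z\<^sup>2)" if z: "0 \<le> z" "z < e" for z
  proof -
    have "pot m f z - poly q (z\<^sup>2) = pot m f 0 - poly q (0\<^sup>2)"
    proof (rule has_derivative_zero_interval_constant[of 0 z "\<lambda>z. pot m f z - poly q (z\<^sup>2)"])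
      show "continuous_on {0..z} (\<lambda>z. pot m f z - poly q (z\<^sup>2))"
        by (intro continuous_intros continuous_on_subset[OF pot_continuous]) auto
      show "((\<lambda>z. pot m f z - poly q (z\<^sup>2)) has_real_derivative 0) (at y)" if "0 < y" "y < z" for y
        using DERIV_diff[OF pot_deriv[OF that(1)] q'[of y]] pot_ratio_near_0[OF e reg p, of y m] that z by simp
    qed (use z in auto)
    moreover have "poly q (0\<^sup>2) = pot m f 0" unfolding q by simp
    ultimately show ?thesis by simp
  qed
  with e pot_continuous show ?thesis by (intro regularI) auto
qed

lemma smooth_pot:
  assumes "smooth {0<..} f"
  shows "smooth {0<..} (pot m f)"
proof -
  have "smooth {0<..} (flux m f)"
    by (rule smooth_deriv_intro[OF flux_has_derivative[OF reg]])
       (auto intro!: smooth_mult[OF smooth_power[OF smooth_ident] assms])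
  then have "smooth {0<..} (\<lambda>z. - (flux m f z * inverse (z ^ m)))"
    by (intro smooth_minus smooth_mult smooth_inverse smooth_power smooth_ident) auto
  then show ?thesis
    by (intro smooth_deriv_intro[OF pot_deriv]) (auto simp: divide_inverse)
qed

lemma C_infinity_pot:
  assumes "smooth {0<..} f"
  shows "(\<lambda>z. pot m f \<bar>z\<bar>) \<in> C_infinity"
  using regular_pot
  by (rule regularE) (intro smooth_UNIV_imp_C_infinity smooth_even_extension[OF smooth_pot[OF assms]])

lemma pot_even_equation:
  assumes "z \<noteq> 0"
  shows "- deriv (deriv (\<lambda>z. pot m f \<bar>z\<bar>)) z - real m / z * deriv (\<lambda>z. pot m f \<bar>z\<bar>) z = f \<bar>z\<bar>"
proof -
  have ab: "((\<lambda>z. \<bar>z\<bar>) has_real_derivative sgn y) (at y)" if "y \<noteq> 0" for y :: real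
  proof (cases "y > 0")
    case True
    show ?thesis
    proof (rule has_field_derivative_transform_within_open[where S = "{0<..}"])
      show "((\<lambda>x. x) has_real_derivative sgn y) (at y)" using True by simp
    qed (use True in auto)
  next
    case False
    show ?thesis
    proof (rule has_field_derivative_transform_within_open[where S = "{..<0}"])
      show "((\<lambda>x. - x) has_real_derivative sgn y) (at y)"
        using False that DERIV_minus[OF DERIV_ident, of y] by simp
    qed (use False that in auto)
  qed
  \<comment> \<open>The chain rule through the absolute value contributes \<open>sgn z\<close>, so
    the derivative of the even extension is odd.\<close>
  define v where "v = (\<lambda>z. - (flux m f \<bar>z\<bar> / \<bar>z\<bar> ^ m) * sgn z)"
  have d: "((\<lambda>z. pot m f \<bar>z\<bar>) has_real_derivative v y) (at y)" if "y \<noteq> 0" for y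
    using DERIV_chain2[OF pot_deriv ab[OF that], of ] that by (simp add: v_def)
  \<comment> \<open>On the half line through \<open>z\<close>, written
    \<open>{y. y * z > 0}\<close>, the sign is frozen at \<open>sgn z\<close>; the two factors
    \<open>sgn z\<close> then cancel.\<close>
  have "(v has_real_derivative - (f \<bar>z\<bar> - real m / \<bar>z\<bar> * (flux m f \<bar>z\<bar> / \<bar>z\<bar> ^ m))) (at z)"
  proof (rule has_field_derivative_transform_within_open)
    have "((\<lambda>y. - (flux m f \<bar>y\<bar> / \<bar>y\<bar> ^ m) * sgn z) has_real_derivative
        - ((f \<bar>z\<bar> - real m / \<bar>z\<bar> * (flux m f \<bar>z\<bar> / \<bar>z\<bar> ^ m)) * sgn z) * sgn z) (at z)"
      using assms by (intro DERIV_cmult_right DERIV_minus DERIV_chain2[OF flux_quotient_deriv ab]) auto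
    then show "((\<lambda>y. - (flux m f \<bar>y\<bar> / \<bar>y\<bar> ^ m) * sgn z) has_real_derivative
        - (f \<bar>z\<bar> - real m / \<bar>z\<bar> * (flux m f \<bar>z\<bar> / \<bar>z\<bar> ^ m))) (at z)"
      using assms by (simp add: sgn_if split: if_splits)
    show "open {y. y * z > 0}" by (intro open_Collect_less continuous_intros)
    show "z \<in> {y. y * z > 0}" using assms by (auto simp: zero_less_mult_iff)
    show "- (flux m f \<bar>y\<bar> / \<bar>y\<bar> ^ m) * sgn z = v y" if "y \<in> {y. y * z > 0}" for y
      using that by (auto simp: v_def sgn_if zero_less_mult_iff)
  qed
  then have "deriv v z = - (f \<bar>z\<bar> - real m / \<bar>z\<bar> * (flux m f \<bar>z\<bar> / \<bar>z\<bar> ^ m))"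
    by (rule DERIV_imp_deriv)
  moreover have "deriv (deriv (\<lambda>z. pot m f \<bar>z\<bar>)) z = deriv v z"
  proof (rule deriv_cong_ev[OF _ refl])
    have "\<forall>\<^sub>F y in nhds z. y \<in> - {0}"
      using assms by (intro eventually_nhds_in_open) auto
    then show "\<forall>\<^sub>F y in nhds z. deriv (\<lambda>z. pot m f \<bar>z\<bar>) y = v y"
      by eventually_elim (use d DERIV_imp_deriv in auto)
  qed
  moreover have "deriv (\<lambda>z. pot m f \<bar>z\<bar>) z = v z"
    using d[OF assms] by (rule DERIV_imp_deriv)
  ultimately show ?thesis
    using assms by (simp add: v_def sgn_if abs_if)
qed

text \<open>Uniqueness for zero Cauchy data at 1, by integrating twice:
  \<open>flux m f y + y ^ m * u' y\<close> is constant, hence 0, and then \<open>pot m f - u\<close>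
  has derivative 0.\<close>

lemma pot_unique_near_1:
  assumes e: "e \<le> 1"
    and u: "\<And>z. z \<in> {1-e<..<1+e} \<Longrightarrow> (u has_real_derivative u' z) (at z)"
    and u': "\<And>z. z \<in> {1-e<..<1+e} \<Longrightarrow> (u' has_real_derivative u'' z) (at z)"
    and eq: "\<And>z. z \<in> {1-e<..<1} \<Longrightarrow> u'' z + real m / z * u' z = - f z"
    and "u 1 = 0" "u' 1 = 0" and z: "1 - e < z" "z \<le> 1"
  shows "pot m f z = u z"
proof -
  have I: "y \<in> {1-e<..<1+e}" "y > 0" if "y \<in> {z..1}" for y using that z e by auto
  have cont: "continuous_on {z..1} u" "continuous_on {z..1} u'"
    using DERIV_isCont[OF u[OF I(1)]] DERIV_isCont[OF u'[OF I(1)]]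
    by (auto intro!: continuous_at_imp_continuous_on)
  have fl: "flux m f y = - (y ^ m * u' y)" if y: "y \<in> {z..1}" for y
  proof -
    have "flux m f y + y ^ m * u' y = flux m f 1 + 1 ^ m * u' 1"
    proof (rule has_derivative_zero_interval_constant[of z 1 "\<lambda>y. flux m f y + y ^ m * u' y"])
      show "continuous_on {z..1} (\<lambda>y. flux m f y + y ^ m * u' y)"
        using z e by (intro continuous_intros continuous_on_subset[OF flux_continuous[OF reg]] cont) auto
      show "((\<lambda>y. flux m f y + y ^ m * u' y) has_real_derivative 0) (at x)" if x: "z < x" "x < 1" for x
      proof -
        have x0: "x > 0" "x \<noteq> 0" and xI: "x \<in> {1-e<..<1+e}" using x I[of x] by auto
        have "((\<lambda>y. flux m f y + y ^ m * u' y) has_real_derivative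
            x ^ m * f x + (real m * x ^ m / x * u' x + u'' x * x ^ m)) (at x)"
          by (intro DERIV_add flux_has_derivative reg x0 DERIV_mult DERIV_power_quotient u' xI)
        also have "x ^ m * f x + (real m * x ^ m / x * u' x + u'' x * x ^ m)
            = x ^ m * (f x + (u'' x + real m / x * u' x))"
          by (simp add: algebra_simps)
        finally show ?thesis using eq[of x] x z by simp
      qed
    qed (use y z in auto)
    then show ?thesis using flux_1 \<open>u' 1 = 0\<close> by simp
  qed
  have "pot m f z - u z = pot m f 1 - u 1"
  proof (rule has_derivative_zero_interval_constant[of z 1 "\<lambda>y. pot m f y - u y"])
    show "continuous_on {z..1} (\<lambda>y. pot m f y - u y)"
      using z e by (intro continuous_intros continuous_on_subset[OF pot_continuous] cont) auto
    show "((\<lambda>y. pot m f y - u y) has_real_derivative 0) (at x)" if x: "z < x" "x < 1" for x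
    proof -
      have "x > 0" "x \<in> {1-e<..<1+e}" using x I[of x] by auto
      then show ?thesis
        using DERIV_diff[OF pot_deriv[of x] u[of x]] fl[of x] x by simp
    qed
  qed (use z in auto)
  then show ?thesis using \<open>u 1 = 0\<close> pot_vanish[of 1] by simp
qed

end

subsection \<open>From the cubed source to the three functions\<close>

lemma positive_near:
  fixes f :: "real \<Rightarrow> real"
  assumes "smooth {a - e<..<a + e} f" "e > 0" "f a > 0" "d > 0"
  obtains e' where "0 < e'" "e' \<le> e" "e' \<le> d" "\<And>z. z \<in> {a - e'<..<a + e'} \<Longrightarrow> f z > 0"
proof -
  have "isCont f a"
    using smooth_imp_continuous_on[OF assms(1)] assms(2) by (simp add: continuous_on_eq_continuous_at)
  then have "\<forall>\<^sub>F z in nhds a. f z > 0"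
    using assms(3) by (auto simp: isCont_def tendsto_at_iff_tendsto_nhds intro: order_tendstoD)
  then obtain s where s: "s > 0" "\<And>z. dist z a < s \<Longrightarrow> f z > 0"
    by (auto simp: eventually_nhds_metric)
  show thesis
    by (rule that[of "min s (min e d)"]) (use s assms in \<open>auto simp: dist_real_def\<close>)
qed

text \<open>The equations are read backwards from \<open>A\<close>. The Laplacian of
  \<open>flat 1 0 (1 - z\<^sup>2)\<close> is \<open>flat 1 (- 4) (1 - z\<^sup>2)\<close> times a
  factor positive near 1; minus its cube root is the germ \<open>b\<close> of \<open>B\<close>, and
  the Laplacian of the cube root is the germ of \<open>D\<close>, positive left of 1. The last two
  conclusions recover the germs from the sources by uniqueness.\<close>

lemma boundary_profile:
  obtains e b l where "0 < e" "e \<le> 1/16" "smooth {1-e<..<1+e} l" "\<And>z. z \<in> {1-e<..<1+e} \<Longrightarrow> l z > 0"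
    "\<And>d f z. d \<le> e \<Longrightarrow> balanced m f
       \<Longrightarrow> (\<And>z. z \<in> {1-d<..<1} \<Longrightarrow> f z = flat (1/3) (- 16/3) (1 - z\<^sup>2) * l z)
       \<Longrightarrow> 1 - d < z \<Longrightarrow> z < 1 \<Longrightarrow> pot m f z = b z"
    "\<And>d f z. d \<le> e \<Longrightarrow> balanced m f \<Longrightarrow> (\<And>z. z \<in> {1-d<..<1} \<Longrightarrow> f z = b z ^ 3)
       \<Longrightarrow> 1 - d < z \<Longrightarrow> z < 1 \<Longrightarrow> pot m f z = exp (- (1 / (1 - z\<^sup>2)))"
proof -
  define a1 where "a1 = (\<lambda>z::real. flat 1 0 (1 - z\<^sup>2) * 1)"
  obtain a1' a1'' l1 where
    l1: "smooth {1-1<..<1+1} l1" "l1 1 = 4 * 1\<^sup>2 * 1" and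
    a1: "\<And>z. z \<in> {1-1<..<1+1} \<Longrightarrow> (a1 has_real_derivative a1' z) (at z)"
    "\<And>z. z \<in> {1-1<..<1+1} \<Longrightarrow> (a1' has_real_derivative a1'' z) (at z)"
    "\<And>z. z \<in> {1-1<..<1+1} \<Longrightarrow> a1'' z + (real (Suc m) - 1) / z * a1' z = flat 1 (0 - 4) (1 - z\<^sup>2) * l1 z"
    "\<And>z. z \<ge> 1 \<Longrightarrow> a1' z = 0"
    unfolding a1_def
    by (rule flat_laplacian[of 1 1 "\<lambda>z. 1" 0 "Suc m"]) (auto intro: smooth_const)
  obtain e1 where e1: "0 < e1" "e1 \<le> 1" "\<And>z. z \<in> {1 - e1<..<1 + e1} \<Longrightarrow> l1 z > 0"
    using positive_near[OF l1(1)] l1(2) by (metis mult.right_neutral one_power2 zero_less_numeral zero_less_one)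
  define k where "k = (\<lambda>z. root 3 (l1 z))"
  have k: "smooth {1 - e1<..<1 + e1} k"
    unfolding k_def by (intro smooth_root3_pos smooth_subset[OF l1(1)] e1(3)) (use e1 in auto)
  have k1: "k 1 > 0" using l1(2) by (simp add: k_def)
  \<comment> \<open>A third of the rate 1 and of the exponent -4, so that \<open>b1 z ^ 3\<close> is
    the Laplacian of \<open>a1\<close>.\<close>
  define b1 where "b1 = (\<lambda>z::real. flat (1/3) (- 4/3) (1 - z\<^sup>2) * k z)"
  obtain b1' b1'' l2 where
    l2: "smooth {1-e1<..<1+e1} l2" "l2 1 = 4 * (1/3)\<^sup>2 * k 1" and
    b1: "\<And>z. z \<in> {1-e1<..<1+e1} \<Longrightarrow> (b1 has_real_derivative b1' z) (at z)"
    "\<And>z. z \<in> {1-e1<..<1+e1} \<Longrightarrow> (b1' has_real_derivative b1'' z) (at z)"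
    "\<And>z. z \<in> {1-e1<..<1+e1} \<Longrightarrow> b1'' z + (real (Suc m) - 1) / z * b1' z = flat (1/3) (- 4/3 - 4) (1 - z\<^sup>2) * l2 z"
    "\<And>z. z \<ge> 1 \<Longrightarrow> b1' z = 0"
    unfolding b1_def
    by (rule flat_laplacian[of "1/3" e1 k "- 4/3" "Suc m"]) (use e1 k in auto)
  have "l2 1 > 0" using l2(2) k1 by simp
  \<comment> \<open>The bound 1/16 keeps the boundary zone to the right of 7/8, away from everything
    built in the interior.\<close>
  then obtain e where e: "0 < e" "e \<le> e1" "e \<le> 1/16" "\<And>z. z \<in> {1 - e<..<1 + e} \<Longrightarrow> l2 z > 0"
    using positive_near[OF l2(1) e1(1), of "1/16"] by auto
  show thesis
  proof (rule that[of e l2 "\<lambda>z. - b1 z"])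
    show "smooth {1-e<..<1+e} l2" using l2(1) e by (auto intro: smooth_subset)
    show "pot m f z = - b1 z"
      if d: "d \<le> e" and f: "balanced m f" "\<And>z. z \<in> {1-d<..<1} \<Longrightarrow> f z = flat (1/3) (- 16/3) (1 - z\<^sup>2) * l2 z"
        and z: "1 - d < z" "z < 1" for d f z
    proof (rule balanced.pot_unique_near_1[OF f(1), of d _ "\<lambda>z. - b1' z" "\<lambda>z. - b1'' z"])
      fix z assume z: "z \<in> {1-d<..<1+d}"
      then have z1: "z \<in> {1-e1<..<1+e1}" using e d by auto
      show "((\<lambda>z. - b1 z) has_real_derivative - b1' z) (at z)" by (intro DERIV_minus b1 z1)
      show "((\<lambda>z. - b1' z) has_real_derivative - b1'' z) (at z)" by (intro DERIV_minus b1 z1)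
    next
      fix z assume z: "z \<in> {1-d<..<1}"
      then have z1: "z \<in> {1-e1<..<1+e1}" using e d by auto
      show "- b1'' z + real m / z * - b1' z = - f z"
        using b1(3)[OF z1] f(2)[OF z] by simp
    qed (use e d b1(4)[of 1] z in \<open>auto simp: b1_def flat_eq_0\<close>)
    show "pot m f z = exp (- (1 / (1 - z\<^sup>2)))"
      if d: "d \<le> e" and f: "balanced m f" "\<And>z. z \<in> {1-d<..<1} \<Longrightarrow> f z = (- b1 z) ^ 3"
        and z: "1 - d < z" "z < 1" for d f z
    proof -
      have "pot m f z = a1 z"
      proof (rule balanced.pot_unique_near_1[OF f(1), of d _ a1' a1''])
        fix z assume z: "z \<in> {1-d<..<1+d}"
        then have z1: "z \<in> {1-1<..<1+1}" using e e1 d by auto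
        show "(a1 has_real_derivative a1' z) (at z)" by (intro a1 z1)
        show "(a1' has_real_derivative a1'' z) (at z)" by (intro a1 z1)
      next
        fix z assume z: "z \<in> {1-d<..<1}"
        then have z1: "z \<in> {1-1<..<1+1}" using e e1 d by auto
        have "flat (1/3) (- 4/3) (1 - z\<^sup>2) = root 3 (flat 1 (0 - 4) (1 - z\<^sup>2))"
          by (simp add: root3_flat)
        then have "b1 z ^ 3 = flat 1 (0 - 4) (1 - z\<^sup>2) * l1 z"
          by (simp add: b1_def k_def power_mult_distrib odd_real_root_pow)
        then show "a1'' z + real m / z * a1' z = - f z"
          using a1(3)[OF z1] f(2)[OF z] by simp
      qed (use e e1 d a1(4)[of 1] z in \<open>auto simp: a1_def flat_eq_0\<close>)
      also have "1 - z\<^sup>2 > 0"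
        using z d e by (simp add: abs_square_less_1)
      then have "a1 z = exp (- (1 / (1 - z\<^sup>2)))" by (simp add: a1_def flat_def)
      finally show ?thesis .
    qed
  qed (use e in auto)
qed

text \<open>All that is asked of \<open>D = C\<^sup>3\<close>. Exact cubes at \<open>a\<close> and
  \<open>b\<close> make the cube root a polynomial with simple zeros there, constancy near 0 makes
  it even and smooth, and near 1 it is flat times a smooth factor. The integral conditions are
  \<open>flux_1\<close>, \<open>pot_half\<close> and \<open>flux_cube\<close>.\<close>

locale cubic_source = D: balanced m D for m D +
  fixes a b d e s :: real and l :: "real \<Rightarrow> real"
  assumes ab: "1/2 < a" "a < b" "b < 1 - e" and e: "0 < e"
    and smooth_D: "smooth {0<..} D"
    and D_const: "d > 0" "\<And>z. z < 1/8 \<Longrightarrow> D z = d"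
    and D_signs: "\<And>z. 0 \<le> z \<Longrightarrow> z < a \<Longrightarrow> D z > 0" "\<And>z. a < z \<Longrightarrow> z < b \<Longrightarrow> D z < 0"
      "\<And>z. b < z \<Longrightarrow> z < 1 \<Longrightarrow> D z > 0"
    and s: "s > 0" and D_roots: "\<And>z. \<bar>z - a\<bar> < s \<or> \<bar>z - b\<bar> < s \<Longrightarrow> D z = ((a - z) * (b - z)) ^ 3"
    and l: "smooth {1-e<..<1+e} l" "\<And>z. z \<in> {1-e<..<1+e} \<Longrightarrow> l z > 0"
    and D_near_1: "\<And>z. z \<in> {1-e<..<1+e} \<Longrightarrow> D z = flat (1/3) (- 16/3) (1 - z\<^sup>2) * l z"
    and pot_half: "pot m D (1/2) = 0"
    and flux_cube: "flux m (\<lambda>z. pot m D z ^ 3) 1 = 0"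
begin

abbreviation "B \<equiv> pot m D"
abbreviation "G \<equiv> flux m D"

section \<open>Signs of the flux and of \<open>B\<close>\<close>

lemma flux_strict_mono:
  assumes "0 \<le> x" "x < y" "\<And>t. x < t \<Longrightarrow> t < y \<Longrightarrow> D t > 0"
  shows "G x < G y"
proof (rule DERIV_pos_imp_increasing_open[OF assms(2)])
  show "\<exists>y. (G has_real_derivative y) (at t) \<and> y > 0" if "x < t" "t < y" for t
    using flux_has_derivative[OF D.reg, of t m] assms(1) assms(3)[OF that] that
    by (intro exI[of _ "t ^ m * D t"]) auto
qed (use assms in \<open>auto intro: continuous_on_subset[OF flux_continuous[OF D.reg]]\<close>)

lemma flux_strict_antimono:
  assumes "0 \<le> x" "x < y" "\<And>t. x < t \<Longrightarrow> t < y \<Longrightarrow> D t < 0"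
  shows "G y < G x"
proof (rule DERIV_neg_imp_decreasing_open[OF assms(2)])
  show "\<exists>y. (G has_real_derivative y) (at t) \<and> y < 0" if "x < t" "t < y" for t
    using flux_has_derivative[OF D.reg, of t m] assms(1) assms(3)[OF that] that
    by (intro exI[of _ "t ^ m * D t"]) (auto simp: mult_pos_neg)
qed (use assms in \<open>auto intro: continuous_on_subset[OF flux_continuous[OF D.reg]]\<close>)

lemma pot_strict_antimono:
  assumes "0 \<le> x" "x < y" "\<And>t. x < t \<Longrightarrow> t < y \<Longrightarrow> G t > 0"
  shows "B y < B x"
proof (rule DERIV_neg_imp_decreasing_open[OF assms(2)])
  show "\<exists>y. (B has_real_derivative y) (at t) \<and> y < 0" if "x < t" "t < y" for t
    using D.pot_deriv[of t] assms(1) assms(3)[OF that] that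
    by (intro exI[of _ "- (G t / t ^ m)"]) auto
qed (use assms in \<open>auto intro: continuous_on_subset[OF D.pot_continuous]\<close>)

lemma pot_strict_mono:
  assumes "0 \<le> x" "x < y" "\<And>t. x < t \<Longrightarrow> t < y \<Longrightarrow> G t < 0"
  shows "B x < B y"
proof (rule DERIV_pos_imp_increasing_open[OF assms(2)])
  show "\<exists>y. (B has_real_derivative y) (at t) \<and> y > 0" if "x < t" "t < y" for t
    using D.pot_deriv[of t] assms(1) assms(3)[OF that] that
    by (intro exI[of _ "- (G t / t ^ m)"]) (auto simp: divide_neg_pos)
qed (use assms in \<open>auto intro: continuous_on_subset[OF D.pot_continuous]\<close>)

lemma flux_pos: "0 < z \<Longrightarrow> z \<le> a \<Longrightarrow> G z > 0"
  using flux_strict_mono[of 0 z] D_signs(1) by (simp add: flux_0)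

lemma flux_neg: "b \<le> z \<Longrightarrow> z < 1 \<Longrightarrow> G z < 0"
  using flux_strict_mono[of z 1] D_signs(3) ab D.flux_1 by simp

text \<open>The flux rises up to \<open>a\<close>, falls up to \<open>b\<close> and rises to 0 at 1,
  so it changes sign once: a point with nonnegative flux lies before \<open>b\<close>, and between
  \<open>a\<close> and \<open>b\<close> earlier values are larger.\<close>

lemma flux_pos_before:
  assumes "G z \<ge> 0" "z < 1" "0 < t" "t < z"
  shows "G t > 0"
proof (cases "t \<le> a")
  case False
  have "z < b" using assms flux_neg[of z] by force
  then have "G z < G t"
    using False assms ab by (intro flux_strict_antimono D_signs(2)) auto
  then show ?thesis using assms by simp
qed (use assms flux_pos in auto)

lemma flux_neg_after:
  assumes "G z < 0" "0 < z" "z < t" "t < 1"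
  shows "G t < 0"
  using flux_pos_before[of t z] assms by force

lemma pot_pos: "0 \<le> z \<Longrightarrow> z < 1/2 \<Longrightarrow> B z > 0"
  using pot_strict_antimono[of z "1/2"] flux_pos ab pot_half by simp

text \<open>Where the flux is still nonnegative, \<open>B\<close> has decreased from
  \<open>B (1/2) = 0\<close>; once it is negative it stays so, and \<open>B\<close> increases to
  \<open>B 1 = 0\<close>.\<close>

lemma pot_neg:
  assumes "1/2 < z" "z < 1"
  shows "B z < 0"
proof (cases "G z \<ge> 0")
  case True
  then show ?thesis
    using pot_strict_antimono[of "1/2" z] flux_pos_before[of z] assms pot_half by simp
next
  case False
  then show ?thesis
    using pot_strict_mono[of z 1] flux_neg_after[of z] assms D.pot_vanish[of 1] by simp
qed

section \<open>The cube root \<open>C\<close>\<close>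

definition C :: "real \<Rightarrow> real" where "C z = root 3 (D z)"

text \<open>Four kinds of open pieces cover the half line: the polynomial
  \<open>(a - z) * (b - z)\<close> near the zeros, roots of functions of constant sign between them,
  a flat function with a third of the exponents around 1, and 0 beyond 1.\<close>

lemma smooth_C: "smooth {0<..} C"
proof -
  have near: "smooth {x - s<..<x + s} C" if "x = a \<or> x = b" for x
  proof (rule smooth_cong)
    show "smooth {x - s<..<x + s} (\<lambda>z. (a - z) * (b - z))"
      by (intro smooth_mult smooth_diff smooth_const smooth_ident)
    show "(a - z) * (b - z) = C z" if "z \<in> {x - s<..<x + s}" for z
    proof -
      have "D z = ((a - z) * (b - z)) ^ 3"
        by (rule D_roots) (use \<open>x = a \<or> x = b\<close> that in auto)
      then show ?thesis by (simp add: C_def odd_real_root_power_cancel)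
    qed
  qed auto
  have near1: "smooth {1 - e<..<1 + e} C"
  proof (rule smooth_cong)
    show "smooth {1 - e<..<1 + e} (\<lambda>z. flat (1/9) (- 16/9) (1 - z\<^sup>2) * root 3 (l z))"
      by (intro smooth_mult smooth_root3_pos l smooth_compose[OF smooth_flat[of _ UNIV]] smooth_diff smooth_const
          smooth_power smooth_ident) auto
    show "flat (1/9) (- 16/9) (1 - z\<^sup>2) * root 3 (l z) = C z" if "z \<in> {1 - e<..<1 + e}" for z
      using D_near_1[OF that] by (simp add: C_def real_root_mult root3_flat)
  qed auto
  have far: "smooth {1<..} C"
    by (rule smooth_cong[OF _ smooth_const[of _ 0]]) (auto simp: C_def D.vanish)
  have pos: "smooth S C" if "open S" "S \<subseteq> {0<..}" "\<And>z. z \<in> S \<Longrightarrow> D z > 0" for S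
    using that unfolding C_def by (intro smooth_root3_pos smooth_subset[OF smooth_D]) auto
  have neg: "smooth S C" if "open S" "S \<subseteq> {0<..}" "\<And>z. z \<in> S \<Longrightarrow> D z < 0" for S
    using that unfolding C_def by (intro smooth_root3_neg smooth_subset[OF smooth_D]) auto
  have 1: "smooth {0<..<a} C" by (rule pos) (use D_signs in auto)
  have 2: "smooth {a<..<b} C" by (rule neg) (use D_signs ab in auto)
  have 3: "smooth {b<..<1} C" by (rule pos) (use D_signs ab in auto)
  have "smooth ({0<..<a} \<union> {a<..<b} \<union> {b<..<1} \<union> {a - s<..<a + s} \<union> {b - s<..<b + s}
      \<union> {1 - e<..<1 + e} \<union> {1<..}) C"
    by (intro smooth_Un 1 2 3 near near1 far open_Un) auto
  then show ?thesis
    by (rule smooth_subset) (use s e ab in auto)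
qed

lemma C_infinity_C: "(\<lambda>z. C \<bar>z\<bar>) \<in> C_infinity"
  by (intro smooth_UNIV_imp_C_infinity smooth_even_extension[OF smooth_C, of "1/8" "[:root 3 d:]"])
     (auto simp: C_def D_const)

lemma deriv_C_nonzero:
  assumes "0 \<le> z" "z < 1" "C z = 0"
  shows "z > 0 \<and> deriv (\<lambda>z. C \<bar>z\<bar>) z \<noteq> 0"
proof -
  have "D z = 0" using assms by (simp add: C_def)
  then have z: "z = a \<or> z = b"
    using D_signs(1)[of z] D_signs(2)[of z] D_signs(3)[of z] assms by force
  then have "z > 0" using ab by auto
  \<comment> \<open>This value is \<open>a - b\<close> at \<open>a\<close> and \<open>b - a\<close>
    at \<open>b\<close>.\<close>
  have "((\<lambda>z. C \<bar>z\<bar>) has_real_derivative - (b - z) - (a - z)) (at z)"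
  proof (rule has_field_derivative_transform_within_open)
    show "((\<lambda>z. (a - z) * (b - z)) has_real_derivative - (b - z) - (a - z)) (at z)"
      by (auto intro!: derivative_eq_intros)
    show "open ({z - s<..<z + s} \<inter> {0<..})" by auto
    show "z \<in> {z - s<..<z + s} \<inter> {0<..}" using s \<open>z > 0\<close> by auto
    show "(a - y) * (b - y) = C \<bar>y\<bar>" if "y \<in> {z - s<..<z + s} \<inter> {0<..}" for y
    proof -
      have "D y = ((a - y) * (b - y)) ^ 3"
        by (rule D_roots) (use z that in auto)
      then show ?thesis using that by (simp add: C_def odd_real_root_power_cancel)
    qed
  qed
  then show ?thesis using \<open>z > 0\<close> z ab by (auto dest!: DERIV_imp_deriv)
qed

text \<open>Makes the facts on balanced sources available for the second integration, which produces
  \<open>A\<close>.\<close>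

sublocale BB: balanced m "\<lambda>z. B z ^ 3"
  by unfold_locales (auto intro: regular_power D.regular_pot simp: D.pot_vanish flux_cube)

lemma supp_subset:
  assumes "\<And>z. z \<ge> 1 \<Longrightarrow> f z = 0"
  shows "supp (\<lambda>z. f \<bar>z\<bar>) \<subseteq> {-1..1}"
proof -
  have "support_on UNIV (\<lambda>z. f \<bar>z\<bar>) \<subseteq> {-1..1}"
  proof
    fix z assume "z \<in> support_on UNIV (\<lambda>z. f \<bar>z\<bar>)"
    then have "\<not> \<bar>z\<bar> \<ge> 1"
      using assms[of "\<bar>z\<bar>"] by (auto simp: support_on_def)
    then show "z \<in> {-1..1}" by auto
  qed
  then show ?thesis unfolding supp_def by (intro closure_minimal) auto
qed

lemma smooth_pot_D: "smooth {0<..} B"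
  by (rule D.smooth_pot[OF smooth_D])

lemma deriv_B_half: "deriv (\<lambda>z. B \<bar>z\<bar>) (1/2) < 0"
proof -
  have "((\<lambda>z. B \<bar>z\<bar>) has_real_derivative - (G (1/2) / (1/2) ^ m)) (at (1/2))"
  proof (rule has_field_derivative_transform_within_open)
    show "(B has_real_derivative - (G (1/2) / (1/2) ^ m)) (at (1/2))"
      by (rule D.pot_deriv) simp
    show "open {0::real<..}" by simp
  qed auto
  then have "deriv (\<lambda>z. B \<bar>z\<bar>) (1/2) = - (G (1/2) / (1/2) ^ m)" by (rule DERIV_imp_deriv)
  then show ?thesis using flux_pos[of "1/2"] ab by simp
qed

lemma B_zero_iff: "B \<bar>z\<bar> = 0 \<and> z \<in> {0..<1} \<longleftrightarrow> z = 1/2"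
proof (cases z "1/2 :: real" rule: linorder_cases)
  case equal
  show ?thesis using pot_half unfolding equal by simp
qed (use pot_pos[of z] pot_neg[of z] in auto)

end

subsection \<open>Building blocks and the limit source\<close>

lemma nondecreasing_on_interval:
  fixes f :: "real \<Rightarrow> real"
  assumes "x \<le> y" "continuous_on {x..y} f"
    and "\<And>t. x < t \<Longrightarrow> t < y \<Longrightarrow> (f has_real_derivative f' t) (at t) \<and> f' t \<ge> 0"
  shows "f x \<le> f y"
proof (cases "x = y")
  case False
  then show ?thesis
    using assms by (intro DERIV_nonneg_imp_increasing_open[of x y f]) blast+
qed simp

lemma flux_mono_interval:
  assumes f: "regular f" and "0 \<le> x" "x \<le> y" "\<And>t. x < t \<Longrightarrow> t < y \<Longrightarrow> f t \<ge> 0"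
  shows "flux m f x \<le> flux m f y"
proof (rule nondecreasing_on_interval[OF assms(3), where f' = "\<lambda>t. t ^ m * f t"])
  show "continuous_on {x..y} (flux m f)"
    using assms(2) by (intro continuous_on_subset[OF flux_continuous[OF f]]) auto
qed (use assms flux_has_derivative[OF f] in auto)

lemma pot_le:
  assumes f: "regular f" and g: "regular g" and "0 \<le> z" "z \<le> w" "w \<le> 2"
    and le: "\<And>y. z < y \<Longrightarrow> y < w \<Longrightarrow> flux m g y \<le> flux m f y"
  shows "pot m g z - pot m g w \<le> pot m f z - pot m f w"
proof -
  have "pot m g z - pot m f z \<le> pot m g w - pot m f w"
  proof (rule nondecreasing_on_interval[OF assms(4), of "\<lambda>z. pot m g z - pot m f z" "\<lambda>y. - (flux m g y / y ^ m) - - (flux m f y / y ^ m)"])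
    show "continuous_on {z..w} (\<lambda>z. pot m g z - pot m f z)"
      using assms by (intro continuous_on_diff continuous_on_subset[OF pot_continuous]) auto
    fix y assume y: "z < y" "y < w"
    have "flux m g y / y ^ m \<le> flux m f y / y ^ m"
      using le[OF y] y assms(3) by (intro divide_right_mono) auto
    then show "((\<lambda>z. pot m g z - pot m f z) has_real_derivative - (flux m g y / y ^ m) - - (flux m f y / y ^ m)) (at y) \<and>
        0 \<le> - (flux m g y / y ^ m) - - (flux m f y / y ^ m)"
      using y assms by (auto intro!: DERIV_diff pot_has_derivative simp del: diff_minus_eq_add)
  qed
  then show ?thesis by simp
qed

text \<open>Mass placed further out gives a smaller flux and so a smaller potential; this will order
  the potentials of the bumps at 1/2. The difference is estimated on three intervals cut at
  \<open>x\<close> and \<open>w\<close>, strictly on the middle one.\<close>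

lemma pot_less:
  assumes f: "regular f" and g: "regular g" and z: "0 \<le> z" "z \<le> x" "x < w" "w \<le> 2"
    and le: "\<And>y. z \<le> y \<Longrightarrow> flux m g y \<le> flux m f y"
    and less: "\<And>y. x < y \<Longrightarrow> y < w \<Longrightarrow> flux m g y < flux m f y"
  shows "pot m g z < pot m f z"
proof -
  have "pot m g x - pot m f x < pot m g w - pot m f w"
  proof (rule DERIV_pos_imp_increasing_open[OF z(3)])
    show "continuous_on {x..w} (\<lambda>z. pot m g z - pot m f z)"
      using z f g by (intro continuous_on_diff continuous_on_subset[OF pot_continuous]) auto
    fix y assume y: "x < y" "y < w"
    have "flux m g y / y ^ m < flux m f y / y ^ m"
      using less[OF y] y z by (intro divide_strict_right_mono) auto
    then show "\<exists>d. ((\<lambda>z. pot m g z - pot m f z) has_real_derivative d) (at y) \<and> 0 < d"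
      using y z f g
      by (intro exI[of _ "- (flux m g y / y ^ m) - - (flux m f y / y ^ m)"] conjI DERIV_diff pot_has_derivative) auto
  qed
  moreover have "pot m g z - pot m g x \<le> pot m f z - pot m f x"
    by (rule pot_le[OF f g]) (use z le in auto)
  moreover have "pot m g w - pot m g 2 \<le> pot m f w - pot m f 2"
    by (rule pot_le[OF f g]) (use z le in auto)
  moreover have "pot m h 2 = 0" for h by (simp add: pot_def)
  ultimately show ?thesis by simp
qed

section \<open>Bumps of unit mass\<close>

definition unit_bump :: "nat \<Rightarrow> real \<Rightarrow> real \<Rightarrow> real \<Rightarrow> real" where
  "unit_bump m l r z = inverse (flux m (bump l r) 1) * bump l r z"

context
  fixes m :: nat and l r :: real
  assumes lr: "1/8 \<le> l" "l < r" "r \<le> 1"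
begin

lemma regular_bump: "regular (bump l r)"
  by (rule regular_smooth[OF smooth_bump, of "1/8" _ _ 0]) (use lr in \<open>auto simp: bump_eq_0\<close>)

lemma flux_bump_pos: "flux m (bump l r) 1 > 0"
proof -
  have "0 \<le> flux m (bump l r) l"
    using flux_mono_interval[OF regular_bump, of 0 l m] lr by (simp add: flux_0 bump_nonneg)
  also have "\<dots> < flux m (bump l r) r"
  proof (rule DERIV_pos_imp_increasing_open[OF lr(2)])
    show "\<exists>y. (flux m (bump l r) has_real_derivative y) (at t) \<and> y > 0" if "l < t" "t < r" for t
      using flux_has_derivative[OF regular_bump, of t m] bump_pos[OF that] lr that
      by (intro exI[of _ "t ^ m * bump l r t"]) auto
  qed (use lr in \<open>auto intro: continuous_on_subset[OF flux_continuous[OF regular_bump]]\<close>)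
  also have "\<dots> \<le> flux m (bump l r) 1"
    using flux_mono_interval[OF regular_bump, of r 1 m] lr by (simp add: bump_nonneg)
  finally show ?thesis .
qed

lemma smooth_unit_bump: "smooth UNIV (unit_bump m l r)"
  unfolding unit_bump_def by (intro smooth_mult smooth_const smooth_bump)

lemma regular_unit_bump: "regular (unit_bump m l r)"
  unfolding unit_bump_def by (intro regular_cmult regular_bump)

lemma unit_bump_nonneg: "unit_bump m l r z \<ge> 0"
  using flux_bump_pos by (simp add: unit_bump_def bump_nonneg)

lemma unit_bump_eq_0: "z \<le> l \<or> z \<ge> r \<Longrightarrow> unit_bump m l r z = 0"
  by (simp add: unit_bump_def bump_eq_0)

lemma flux_unit_bump_mono: "0 \<le> x \<Longrightarrow> x \<le> y \<Longrightarrow> flux m (unit_bump m l r) x \<le> flux m (unit_bump m l r) y"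
  by (intro flux_mono_interval regular_unit_bump unit_bump_nonneg)

lemma flux_unit_bump_const:
  assumes "0 \<le> x" "x \<le> y" "y \<le> l \<or> r \<le> x"
  shows "flux m (unit_bump m l r) x = flux m (unit_bump m l r) y"
proof (rule has_derivative_zero_interval_constant[of x y "flux m (unit_bump m l r)"])
  show "(flux m (unit_bump m l r) has_real_derivative 0) (at t)" if "x < t" "t < y" for t
    using flux_has_derivative[OF regular_unit_bump, of t m] unit_bump_eq_0[of t] assms that by auto
qed (use assms in \<open>auto intro: continuous_on_subset[OF flux_continuous[OF regular_unit_bump]]\<close>)

lemma flux_unit_bump_0: "0 \<le> z \<Longrightarrow> z \<le> l \<Longrightarrow> flux m (unit_bump m l r) z = 0"
  using flux_unit_bump_const[of 0 z] by (simp add: flux_0)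

lemma flux_unit_bump_1: "r \<le> z \<Longrightarrow> flux m (unit_bump m l r) z = 1"
proof -
  have one: "flux m (unit_bump m l r) 1 = 1"
    using flux_bump_pos unfolding unit_bump_def flux_cmult by simp
  then show "r \<le> z \<Longrightarrow> flux m (unit_bump m l r) z = 1"
    using flux_unit_bump_const[of z 1] flux_unit_bump_const[of 1 z] lr by (cases "z \<le> 1") auto
qed

lemma flux_unit_bump_bounds: "0 \<le> z \<Longrightarrow> 0 \<le> flux m (unit_bump m l r) z \<and> flux m (unit_bump m l r) z \<le> 1"
  using flux_unit_bump_mono[of 0 z] flux_unit_bump_mono[of z "max z 1"] flux_unit_bump_1[of "max z 1"] lr
  by (simp add: flux_0)

end

text \<open>Constructs the function carrying all germs. \<open>\<phi>\<close> switches from the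
  constant 1 near 0 to the cubed polynomial \<open>p\<close>, and \<open>\<omega>\<close> from
  \<open>p\<close> to the germ at 1. Each transition happens where both functions are positive, so
  convex combination keeps the sign pattern.\<close>

lemma base_source:
  assumes a: "1/2 < a" "a \<le> 5/8" and e: "0 < e" "e \<le> 1/16"
    and l: "smooth {1-e<..<1+e} l" "\<And>z. z \<in> {1-e<..<1+e} \<Longrightarrow> l z > 0"
  obtains D where "smooth UNIV D" "\<And>z. z \<le> 1/8 \<Longrightarrow> D z = 1" "\<And>z. z \<ge> 1 \<Longrightarrow> D z = 0"
    "\<And>z. 0 \<le> z \<Longrightarrow> z < a \<Longrightarrow> D z > 0" "\<And>z. a < z \<Longrightarrow> z < 3/4 \<Longrightarrow> D z < 0" "\<And>z. 3/4 < z \<Longrightarrow> z < 1 \<Longrightarrow> D z > 0"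
    "\<And>z. 1/4 \<le> z \<Longrightarrow> z \<le> 7/8 \<Longrightarrow> D z = ((a - z) * (3/4 - z)) ^ 3"
    "\<And>z. z \<in> {1-e/2<..<1+e/2} \<Longrightarrow> D z = flat (1/3) (- 16/3) (1 - z\<^sup>2) * l z"
proof -
  define \<phi> where "\<phi> = (\<lambda>z. step ((1/4 - z) * 8))"
  \<comment> \<open>Scaled to pass from 0 at \<open>1 - 3 * e / 4\<close> to 1 at
    \<open>1 - e / 2\<close>, inside the interval where \<open>l\<close> is smooth and
    positive.\<close>
  define \<omega> where "\<omega> = (\<lambda>z. step ((z - (1 - 3 * e / 4)) * (4 * inverse e)))"
  define p where "p = (\<lambda>z::real. ((a - z) * (3/4 - z)) ^ 3)"
  define q where "q = (\<lambda>z. \<omega> z * (flat (1/3) (- 16/3) (1 - z\<^sup>2) * l z))"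
  define D where "D = (\<lambda>z. \<phi> z + (1 - \<phi> z) * ((1 - \<omega> z) * p z + q z))"
  have \<phi>: "0 \<le> \<phi> z" "\<phi> z \<le> 1" "z \<le> 1/8 \<Longrightarrow> \<phi> z = 1" "z \<ge> 1/4 \<Longrightarrow> \<phi> z = 0" for z
    by (auto simp: \<phi>_def step_bounds step_eq_0 step_eq_1)
  have \<omega>: "0 \<le> \<omega> z" "\<omega> z \<le> 1" "z \<le> 1 - 3 * e / 4 \<Longrightarrow> \<omega> z = 0" "z \<ge> 1 - e / 2 \<Longrightarrow> \<omega> z = 1" for z
    using e by (auto simp: \<omega>_def step_bounds intro!: step_eq_0 step_eq_1 mult_nonpos_nonneg) (simp add: field_simps)
  have flat_far: "flat (1/3) (- 16/3) (1 - z\<^sup>2) = 0" if "z \<ge> 1" for z :: real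
    using that by (intro flat_eq_0) simp
  have "smooth UNIV \<phi>" unfolding \<phi>_def
    by (intro smooth_compose[OF smooth_step] smooth_mult smooth_diff smooth_const smooth_ident) auto
  moreover have s\<omega>: "smooth S \<omega>" for S unfolding \<omega>_def
    by (intro smooth_compose[OF smooth_step] smooth_mult smooth_diff smooth_const smooth_ident) auto
  moreover have "smooth UNIV p" unfolding p_def
    by (intro smooth_power smooth_mult smooth_diff smooth_const smooth_ident)
  moreover have "smooth UNIV q"
  proof -
    \<comment> \<open>\<open>l\<close> is controlled only on \<open>{1-e<..<1+e}\<close>: to the
      left the factor \<open>\<omega>\<close> kills \<open>q\<close>, to the right the flat factor
      does.\<close>
    have 1: "smooth {..<1 - 3 * e / 4} q"
      by (rule smooth_cong[OF _ smooth_const[of _ 0]]) (auto simp: q_def \<omega>)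
    have 2: "smooth {1-e<..<1+e} q" unfolding q_def
      by (intro smooth_mult s\<omega> l smooth_compose[OF smooth_flat[of _ UNIV]] smooth_diff smooth_const
          smooth_power smooth_ident) auto
    have 3: "smooth {1<..} q"
      by (rule smooth_cong[OF _ smooth_const[of _ 0]]) (use flat_far in \<open>auto simp: q_def\<close>)
    have "smooth ({..<1 - 3 * e / 4} \<union> {1-e<..<1+e} \<union> {1<..}) q"
      by (intro smooth_Un 1 2 3 open_Un) auto
    then show ?thesis by (rule smooth_subset) (use e in auto)
  qed
  ultimately have sD: "smooth UNIV D" unfolding D_def
    by (intro smooth_add smooth_mult smooth_diff smooth_const)
  have mid: "D z = p z" if "1/4 \<le> z" "z \<le> 7/8" for z
    using that e by (simp add: D_def \<phi> \<omega> q_def)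
  have p_pos: "p z > 0" if "z < a \<or> 3/4 < z" for z
    using that a unfolding p_def by (intro zero_less_power) (auto intro: mult_pos_pos mult_neg_neg)
  show thesis
  proof (rule that[OF sD])
    show "D z = 1" if "z \<le> 1/8" for z using that by (simp add: D_def \<phi>)
    show "D z = 0" if "z \<ge> 1" for z
      using that e flat_far[OF that] by (simp add: D_def \<phi> \<omega> q_def)
    show "D z = ((a - z) * (3/4 - z)) ^ 3" if "1/4 \<le> z" "z \<le> 7/8" for z
      using mid[OF that] by (simp add: p_def)
    show "D z > 0" if z: "0 \<le> z" "z < a" for z
    proof -
      have "D z = \<phi> z + (1 - \<phi> z) * p z" using z a e by (simp add: D_def \<omega> q_def)
      moreover have "\<phi> z + (1 - \<phi> z) * p z > 0"
        using \<phi>(1,2)[of z] p_pos[of z] z by (cases "\<phi> z = 0") (auto intro!: add_pos_nonneg)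
      ultimately show ?thesis by simp
    qed
    show "D z < 0" if z: "a < z" "z < 3/4" for z
    proof -
      have "(a - z) * (3/4 - z) < 0" using z by (intro mult_neg_pos) auto
      then show ?thesis using mid[of z] z a by (simp add: p_def)
    qed
    show "D z > 0" if z: "3/4 < z" "z < 1" for z
    proof (cases "z \<le> 1 - 3 * e / 4")
      case True
      then have "D z = p z" using z by (simp add: D_def \<phi> \<omega> q_def)
      then show ?thesis using p_pos z by simp
    next
      case False
      then have "1 - z\<^sup>2 > 0" "l z > 0" using z e l(2)[of z] by (auto simp: abs_square_less_1)
      then have pos: "flat (1/3) (- 16/3) (1 - z\<^sup>2) * l z > 0" by (simp add: flat_pos)
      have "D z = (1 - \<omega> z) * p z + \<omega> z * (flat (1/3) (- 16/3) (1 - z\<^sup>2) * l z)"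
        using z by (simp add: D_def \<phi> q_def)
      moreover have "\<dots> > 0"
        using pos p_pos[of z] z \<omega>(1,2)[of z]
        by (cases "\<omega> z = 0") (auto intro!: add_nonneg_pos)
      ultimately show ?thesis by simp
    qed
    show "D z = flat (1/3) (- 16/3) (1 - z\<^sup>2) * l z" if "z \<in> {1-e/2<..<1+e/2}" for z
      using that e by (simp add: D_def \<phi> \<omega> q_def)
  qed
qed

text \<open>
  The limit \<open>k = 0\<close>, where \<open>M\<close> and \<open>R\<close> have unit mass and \<open>\<tau>\<close> measures how close the mass of \<open>M\<close> is to
  \<open>1/2\<close>, i.e. how negative \<open>pot m (V \<psi>)\<close> can get on the right of \<open>1/2\<close>.
\<close>

locale limit_source =
  fixes m :: nat and \<tau> \<mu> \<rho> :: real and M R :: "real \<Rightarrow> real"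
  assumes \<tau>: "0 < \<tau>" "\<tau> \<le> 1/8" and \<mu>: "0 < \<mu>" "\<mu> < 1" "\<mu> + \<rho> = 1"
    and M: "regular M" "\<And>z. z \<ge> 1 \<Longrightarrow> M z = 0"
      "\<And>z. 0 \<le> z \<Longrightarrow> z \<le> 1/2 + \<tau>/2 \<Longrightarrow> flux m M z = 0" "\<And>z. 1/2 + \<tau> \<le> z \<Longrightarrow> flux m M z = 1"
      "\<And>x y. 0 \<le> x \<Longrightarrow> x \<le> y \<Longrightarrow> flux m M x \<le> flux m M y"
    and R: "regular R" "\<And>z. z \<ge> 1 \<Longrightarrow> R z = 0"
      "\<And>z. 0 \<le> z \<Longrightarrow> z \<le> 1/2 + \<tau> \<Longrightarrow> flux m R z = 0" "flux m R 1 = 1"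
      "\<And>z. 0 \<le> z \<Longrightarrow> flux m R z \<le> 1"
begin

text \<open>The explicit factor \<open>- 1\<close> lets \<open>regular_cmult\<close> and
  \<open>flux_cmult\<close> treat all summands alike.\<close>

definition V :: "(real \<Rightarrow> real) \<Rightarrow> real \<Rightarrow> real" where
  "V \<psi> z = \<mu> * \<psi> z + (- 1 * M z + \<rho> * R z)"

text \<open>Encodes a unit mass left of 1/2 through its flux: beyond 1/2 all admissible choices have
  the same flux.\<close>

definition admissible :: "(real \<Rightarrow> real) \<Rightarrow> bool" where
  "admissible \<psi> \<longleftrightarrow> regular \<psi> \<and> (\<forall>z\<ge>1. \<psi> z = 0) \<and> (\<forall>z\<ge>0. 0 \<le> flux m \<psi> z \<and> flux m \<psi> z \<le> 1)
     \<and> (\<forall>z\<ge>1/2. flux m \<psi> z = 1) \<and> pot m (V \<psi>) (1/2) = 0"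

context
  fixes \<psi> :: "real \<Rightarrow> real"
  assumes adm: "admissible \<psi>"
begin

section \<open>Flux and potential of the limit source\<close>

lemma regular_V: "regular (V \<psi>)"
  unfolding V_def using adm by (intro regular_add regular_cmult M R) (simp add: admissible_def)

lemma flux_V: "flux m (V \<psi>) z = \<mu> * flux m \<psi> z - flux m M z + \<rho> * flux m R z"
proof -
  have \<psi>: "regular \<psi>" using adm by (simp add: admissible_def)
  show ?thesis
    unfolding V_def flux_add[OF regular_cmult[OF \<psi>] regular_add[OF regular_cmult[OF M(1)] regular_cmult[OF R(1)]]]
      flux_add[OF regular_cmult[OF M(1)] regular_cmult[OF R(1)]] flux_cmult
    by simp
qed

lemma balanced_V: "balanced m (V \<psi>)"
proof
  show "V \<psi> z = 0" if "z \<ge> 1" for z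
    using that adm M(2) R(2) by (simp add: V_def admissible_def)
  show "flux m (V \<psi>) 1 = 0"
    using adm M(4)[of 1] R(4) \<mu> \<tau> by (simp add: flux_V admissible_def)
qed (rule regular_V)

lemma balanced_pot_continuous_on: "0 \<le> x \<Longrightarrow> continuous_on {x..y} (pot m (V \<psi>))"
  by (rule continuous_on_subset[OF balanced.pot_continuous[OF balanced_V]]) auto

lemma pot_V_antimono:
  assumes "0 \<le> x" "x \<le> y" "\<And>t. x < t \<Longrightarrow> t < y \<Longrightarrow> flux m (V \<psi>) t \<ge> 0"
  shows "pot m (V \<psi>) y \<le> pot m (V \<psi>) x"
proof -
  have "- pot m (V \<psi>) x \<le> - pot m (V \<psi>) y"
  proof (rule nondecreasing_on_interval[OF assms(2), of "\<lambda>z. - pot m (V \<psi>) z" "\<lambda>t. - (- (flux m (V \<psi>) t / t ^ m))"])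
    show "((\<lambda>z. - pot m (V \<psi>) z) has_real_derivative - (- (flux m (V \<psi>) t / t ^ m))) (at t) \<and>
        0 \<le> - (- (flux m (V \<psi>) t / t ^ m))" if "x < t" "t < y" for t
      by (intro conjI DERIV_minus balanced.pot_deriv[OF balanced_V]) (use assms that in auto)
  qed (intro continuous_intros balanced_pot_continuous_on assms)
  then show ?thesis by simp
qed

lemma pot_V_mono:
  assumes "0 \<le> x" "x \<le> y" "\<And>t. x < t \<Longrightarrow> t < y \<Longrightarrow> flux m (V \<psi>) t \<le> 0"
  shows "pot m (V \<psi>) x \<le> pot m (V \<psi>) y"
proof (rule nondecreasing_on_interval[OF assms(2), of "pot m (V \<psi>)" "\<lambda>t. - (flux m (V \<psi>) t / t ^ m)"])
  show "(pot m (V \<psi>) has_real_derivative - (flux m (V \<psi>) t / t ^ m)) (at t) \<and>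
      0 \<le> - (flux m (V \<psi>) t / t ^ m)" if "x < t" "t < y" for t
    using balanced.pot_deriv[OF balanced_V, of t] assms that by (auto intro: divide_nonpos_nonneg)
qed (intro balanced_pot_continuous_on assms)

lemma pot_V_slope:
  assumes "0 < x" "x \<le> y" "\<And>t. x < t \<Longrightarrow> t < y \<Longrightarrow> flux m (V \<psi>) t \<le> c" "c \<ge> 0"
  shows "pot m (V \<psi>) x - pot m (V \<psi>) y \<le> c / x ^ m * (y - x)"
proof -
  have "pot m (V \<psi>) x + c / x ^ m * x \<le> pot m (V \<psi>) y + c / x ^ m * y"
  proof (rule nondecreasing_on_interval[OF assms(2), of "\<lambda>z. pot m (V \<psi>) z + c / x ^ m * z"
      "\<lambda>t. - (flux m (V \<psi>) t / t ^ m) + c / x ^ m * 1"])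
    fix t assume t: "x < t" "t < y"
    have "flux m (V \<psi>) t / t ^ m \<le> c / t ^ m"
      using assms(1) t assms(3)[OF t] by (intro divide_right_mono) auto
    also have "\<dots> \<le> c / x ^ m"
      using assms(1,4) t by (intro divide_left_mono power_mono mult_pos_pos) auto
    finally have "0 \<le> - (flux m (V \<psi>) t / t ^ m) + c / x ^ m * 1" by simp
    moreover have "((\<lambda>z. pot m (V \<psi>) z + c / x ^ m * z) has_real_derivative
        - (flux m (V \<psi>) t / t ^ m) + c / x ^ m * 1) (at t)"
      using assms(1) t by (intro DERIV_add DERIV_cmult DERIV_ident balanced.pot_deriv[OF balanced_V]) auto
    ultimately show "((\<lambda>z. pot m (V \<psi>) z + c / x ^ m * z) has_real_derivative
        - (flux m (V \<psi>) t / t ^ m) + c / x ^ m * 1) (at t) \<and> 0 \<le> - (flux m (V \<psi>) t / t ^ m) + c / x ^ m * 1"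
      by blast
  qed (use assms(1) in \<open>intro continuous_intros balanced_pot_continuous_on, auto\<close>)
  then show ?thesis by (simp add: algebra_simps diff_divide_distrib)
qed

lemma flux_V_left: "0 \<le> z \<Longrightarrow> z \<le> 1/2 \<Longrightarrow> flux m (V \<psi>) z = \<mu> * flux m \<psi> z"
  using M(3) R(3) \<tau> by (simp add: flux_V)

lemma flux_V_middle: "1/2 \<le> z \<Longrightarrow> z \<le> 1/2 + \<tau> \<Longrightarrow> flux m (V \<psi>) z = \<mu> - flux m M z"
  using R(3) \<tau> adm by (simp add: flux_V admissible_def)

lemma flux_V_right: "1/2 + \<tau> \<le> z \<Longrightarrow> flux m (V \<psi>) z \<le> 0"
proof -
  assume z: "1/2 + \<tau> \<le> z"
  then have "\<rho> * flux m R z \<le> \<rho> * 1"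
    using R(5)[of z] \<tau> \<mu> by (intro mult_left_mono) auto
  moreover have "flux m (V \<psi>) z = \<mu> - 1 + \<rho> * flux m R z"
    using z M(4)[of z] \<tau> adm by (simp add: flux_V admissible_def)
  ultimately show ?thesis using \<mu>(3) by linarith
qed

lemma pot_V_half: "pot m (V \<psi>) (1/2) = 0"
  using adm by (simp add: admissible_def)

lemma pot_V_left_nonneg: "0 \<le> z \<Longrightarrow> z \<le> 1/2 \<Longrightarrow> pot m (V \<psi>) z \<ge> 0"
  using pot_V_antimono[of z "1/2"] pot_V_half adm flux_V_left \<mu> by (simp add: admissible_def)

text \<open>The flux \<open>\<mu> - flux m M\<close> is nonincreasing up to
  \<open>1/2 + \<tau>\<close>, and nonpositive afterwards. So at \<open>z\<close> the potential
  either has only decreased since its zero 1/2 or will only increase up to its zero 1.\<close>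

lemma pot_V_right_nonpos:
  assumes z: "1/2 \<le> z" "z \<le> 1"
  shows "pot m (V \<psi>) z \<le> 0"
proof (cases "z \<le> 1/2 + \<tau> \<and> flux m (V \<psi>) z \<ge> 0")
  case True
  have "flux m (V \<psi>) t \<ge> 0" if "1/2 < t" "t < z" for t
    using True that M(5)[of t z] flux_V_middle[of t] flux_V_middle[of z] z by simp
  then show ?thesis using pot_V_antimono[of "1/2" z] z pot_V_half by simp
next
  case False
  have "flux m (V \<psi>) t \<le> 0" if "z < t" for t
  proof (cases "t \<le> 1/2 + \<tau>")
    case True
    then show ?thesis
      using False that M(5)[of z t] flux_V_middle[of t] flux_V_middle[of z] z by simp
  qed (use flux_V_right in auto)
  then show ?thesis
    using pot_V_mono[of z 1] z balanced.pot_vanish[OF balanced_V, of 1] by simp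
qed

text \<open>The flux can be positive only for a length \<open>\<tau>\<close> after 1/2, where it is
  at most \<open>\<mu>\<close> and the weight is at least \<open>(1/2) ^ m\<close>; this bounds the
  drop.\<close>

lemma pot_V_right_lower:
  assumes z: "1/2 \<le> z" "z \<le> 1"
  shows "- (\<mu> * 2 ^ m * \<tau>) \<le> pot m (V \<psi>) z"
proof -
  have *: "- (\<mu> * 2 ^ m * \<tau>) \<le> pot m (V \<psi>) z" if z: "1/2 \<le> z" "z \<le> 1/2 + \<tau>" for z
  proof -
    have "flux m (V \<psi>) t \<le> \<mu>" if "1/2 < t" "t < z" for t
      using that z flux_V_middle[of t] M(5)[of 0 t] by (simp add: flux_0)
    then have "pot m (V \<psi>) (1/2) - pot m (V \<psi>) z \<le> \<mu> / (1/2) ^ m * (z - 1/2)"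
      using \<mu> z by (intro pot_V_slope) auto
    also have "\<dots> \<le> \<mu> / (1/2) ^ m * \<tau>"
      using \<mu> z by (intro mult_left_mono) auto
    finally show ?thesis using pot_V_half by (simp add: power_divide)
  qed
  show ?thesis
  proof (cases "z \<le> 1/2 + \<tau>")
    case False
    then have "pot m (V \<psi>) (1/2 + \<tau>) \<le> pot m (V \<psi>) z"
      using \<tau> by (intro pot_V_mono flux_V_right) auto
    with *[of "1/2 + \<tau>"] \<tau> show ?thesis by simp
  qed (use * z in auto)
qed

section \<open>The cubic condition for the limit source\<close>

abbreviation (input) "H \<equiv> flux m (\<lambda>z. pot m (V \<psi>) z ^ 3)"

lemma regular_cube: "regular (\<lambda>z. pot m (V \<psi>) z ^ 3)"
  by (intro regular_power balanced.regular_pot balanced_V)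

lemma flux_cube_mono_left: "0 \<le> x \<Longrightarrow> x \<le> y \<Longrightarrow> y \<le> 1/2 \<Longrightarrow> H x \<le> H y"
  by (intro flux_mono_interval regular_cube zero_le_power pot_V_left_nonneg) auto

text \<open>Odd powers are monotone, so \<open>c\<close> may be negative; the weight
  \<open>t ^ m\<close> is integrated exactly.\<close>

lemma flux_cube_lower:
  assumes "0 \<le> x" "x \<le> y" "y \<le> 1" "\<And>t. x < t \<Longrightarrow> t < y \<Longrightarrow> c \<le> pot m (V \<psi>) t"
  shows "c ^ 3 * (y ^ (m + 1) - x ^ (m + 1)) / real (m + 1) \<le> H y - H x"
proof -
  have nz: "real (m + 1) \<noteq> 0" by linarith
  have "H x - c ^ 3 / real (m + 1) * x ^ (m + 1) \<le> H y - c ^ 3 / real (m + 1) * y ^ (m + 1)"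
  proof (rule nondecreasing_on_interval[OF assms(2), of "\<lambda>z. H z - c ^ 3 / real (m + 1) * z ^ (m + 1)"
      "\<lambda>t. t ^ m * pot m (V \<psi>) t ^ 3 - c ^ 3 / real (m + 1) * (real (m + 1) * t ^ (m + 1 - 1))"])
    show "continuous_on {x..y} (\<lambda>z. H z - c ^ 3 / real (m + 1) * z ^ (m + 1))"
      using assms(1) by (intro continuous_intros continuous_on_subset[OF flux_continuous[OF regular_cube]]) auto
    fix t assume t: "x < t" "t < y"
    have "c ^ 3 \<le> pot m (V \<psi>) t ^ 3"
      using assms(4)[OF t] by (intro power_mono_odd) auto
    then have "t ^ m * c ^ 3 \<le> t ^ m * pot m (V \<psi>) t ^ 3"
      using t assms(1) by (intro mult_left_mono) auto
    moreover have "c ^ 3 / real (m + 1) * (real (m + 1) * t ^ (m + 1 - 1)) = t ^ m * c ^ 3"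
      using nz by simp
    moreover have "((\<lambda>z. H z - c ^ 3 / real (m + 1) * z ^ (m + 1)) has_real_derivative
        t ^ m * pot m (V \<psi>) t ^ 3 - c ^ 3 / real (m + 1) * (real (m + 1) * t ^ (m + 1 - 1))) (at t)"
      using t assms(1)
      by (intro DERIV_diff DERIV_cmult DERIV_pow[THEN DERIV_cong] flux_has_derivative regular_cube) auto
    ultimately show "((\<lambda>z. H z - c ^ 3 / real (m + 1) * z ^ (m + 1)) has_real_derivative
        t ^ m * pot m (V \<psi>) t ^ 3 - c ^ 3 / real (m + 1) * (real (m + 1) * t ^ (m + 1 - 1))) (at t) \<and>
        0 \<le> t ^ m * pot m (V \<psi>) t ^ 3 - c ^ 3 / real (m + 1) * (real (m + 1) * t ^ (m + 1 - 1))"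
      by linarith
  qed
  then show ?thesis by (simp add: algebra_simps diff_divide_distrib)
qed

text \<open>Here the weight is only bounded by 1, which is why \<open>c\<close> is
  nonnegative.\<close>

lemma flux_cube_upper:
  assumes "0 \<le> x" "x \<le> y" "y \<le> 1" "\<And>t. x < t \<Longrightarrow> t < y \<Longrightarrow> pot m (V \<psi>) t \<le> c" "0 \<le> c"
  shows "H y - H x \<le> c ^ 3 * (y - x)"
proof -
  have "c ^ 3 * x - H x \<le> c ^ 3 * y - H y"
  proof (rule nondecreasing_on_interval[OF assms(2), of "\<lambda>z. c ^ 3 * z - H z" "\<lambda>t. c ^ 3 * 1 - t ^ m * pot m (V \<psi>) t ^ 3"])
    show "continuous_on {x..y} (\<lambda>z. c ^ 3 * z - H z)"
      using assms(1) by (intro continuous_intros continuous_on_subset[OF flux_continuous[OF regular_cube]]) auto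
    fix t assume t: "x < t" "t < y"
    have "pot m (V \<psi>) t ^ 3 \<le> c ^ 3"
      using assms(4)[OF t] by (intro power_mono_odd) auto
    then have "t ^ m * pot m (V \<psi>) t ^ 3 \<le> t ^ m * c ^ 3"
      using t assms(1) by (intro mult_left_mono) auto
    also have "\<dots> \<le> 1 * c ^ 3"
      using t assms by (intro mult_right_mono power_le_one) auto
    finally have "0 \<le> c ^ 3 * 1 - t ^ m * pot m (V \<psi>) t ^ 3" by simp
    moreover have "((\<lambda>z. c ^ 3 * z - H z) has_real_derivative c ^ 3 * 1 - t ^ m * pot m (V \<psi>) t ^ 3) (at t)"
      using t assms(1)
      by (intro DERIV_diff DERIV_cmult DERIV_ident flux_has_derivative regular_cube) auto
    ultimately show "((\<lambda>z. c ^ 3 * z - H z) has_real_derivative c ^ 3 * 1 - t ^ m * pot m (V \<psi>) t ^ 3) (at t) \<and>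
      0 \<le> c ^ 3 * 1 - t ^ m * pot m (V \<psi>) t ^ 3" by blast
  qed
  then show ?thesis by (simp add: algebra_simps)
qed

text \<open>Up to \<open>1/2 + \<tau>/2\<close> no mass of \<open>M\<close> is met, so the flux is
  \<open>\<mu> > 0\<close> and the potential falls strictly below 0; later it is
  nonpositive.\<close>

lemma flux_cube_right_neg: "H 1 - H (1/2) < 0"
proof -
  have "H (1/2 + \<tau>/2) < H (1/2)"
  proof (rule DERIV_neg_imp_decreasing_open[of _ _ H])
    show "1/2 < 1/2 + \<tau>/2" using \<tau> by simp
    show "continuous_on {1/2..1/2 + \<tau>/2} H"
      by (intro continuous_on_subset[OF flux_continuous[OF regular_cube]]) auto
    fix t assume t: "1/2 < t" "t < 1/2 + \<tau>/2"
    have "pot m (V \<psi>) t < pot m (V \<psi>) (1/2)"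
    proof (rule DERIV_neg_imp_decreasing_open[OF t(1)])
      fix u assume u: "1/2 < u" "u < t"
      have "flux m (V \<psi>) u = \<mu>"
        using flux_V_middle[of u] M(3)[of u] u t \<tau> by simp
      then show "\<exists>d. (pot m (V \<psi>) has_real_derivative d) (at u) \<and> d < 0"
        using balanced.pot_deriv[OF balanced_V, of u] u \<mu>
        by (intro exI[of _ "- (flux m (V \<psi>) u / u ^ m)"]) auto
    qed (auto intro: balanced_pot_continuous_on)
    then have "pot m (V \<psi>) t ^ 3 < 0" using pot_V_half by simp
    then show "\<exists>d. (H has_real_derivative d) (at t) \<and> d < 0"
      using flux_has_derivative[OF regular_cube, of t m] t
      by (intro exI[of _ "t ^ m * pot m (V \<psi>) t ^ 3"]) (auto simp: mult_pos_neg)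
  qed
  moreover have "H 1 - H (1/2 + \<tau>/2) \<le> 0 ^ 3 * (1 - (1/2 + \<tau>/2))"
    by (rule flux_cube_upper) (use \<tau> pot_V_right_nonpos in auto)
  ultimately show ?thesis by simp
qed

text \<open>If \<open>\<psi>\<close> sits before 1/4, the potential decreases at rate at least
  \<open>\<mu>\<close> on [1/4, 1/2], so it is at least \<open>\<mu> / 4\<close> on [0, 1/4]. The
  loss beyond 1/2 is controlled by the cube of \<open>\<mu> * 2 ^ m * \<tau>\<close>. The assumption
  \<open>small\<close> compares the two once \<open>\<mu> ^ 3\<close> and \<open>m + 1\<close> are
  cancelled.\<close>

lemma flux_cube_positive:
  assumes one: "\<And>z. 1/4 \<le> z \<Longrightarrow> flux m \<psi> z = 1"
    and small: "(2 ^ m * \<tau>) ^ 3 < (1/4) ^ 3 * (1/4) ^ (m + 1)"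
  shows "H 1 > 0"
proof -
  have quarter: "\<mu> / 4 \<le> pot m (V \<psi>) z" if z: "0 \<le> z" "z \<le> 1/4" for z
  proof -
    have "pot m (V \<psi>) (1/2) + \<mu> * (1/2) \<le> pot m (V \<psi>) (1/4) + \<mu> * (1/4)"
    proof -
      have "- (pot m (V \<psi>) (1/4) + \<mu> * (1/4)) \<le> - (pot m (V \<psi>) (1/2) + \<mu> * (1/2))"
      proof (rule nondecreasing_on_interval[of "1/4" "1/2" "\<lambda>z. - (pot m (V \<psi>) z + \<mu> * z)" "\<lambda>t. - (- (flux m (V \<psi>) t / t ^ m) + \<mu> * 1)"])
        fix t :: real assume t: "1/4 < t" "t < 1/2"
        have "t ^ m \<le> 1" using t by (intro power_le_one) auto
        then have "\<mu> \<le> \<mu> / t ^ m" using \<mu> t by (simp add: field_simps)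
        then have "0 \<le> - (- (flux m (V \<psi>) t / t ^ m) + \<mu> * 1)"
          using t one[of t] by (simp add: flux_V_left)
        moreover have "((\<lambda>z. - (pot m (V \<psi>) z + \<mu> * z)) has_real_derivative - (- (flux m (V \<psi>) t / t ^ m) + \<mu> * 1)) (at t)"
          using t by (intro DERIV_minus DERIV_add DERIV_cmult DERIV_ident balanced.pot_deriv[OF balanced_V]) auto
        ultimately show "((\<lambda>z. - (pot m (V \<psi>) z + \<mu> * z)) has_real_derivative - (- (flux m (V \<psi>) t / t ^ m) + \<mu> * 1)) (at t)
            \<and> 0 \<le> - (- (flux m (V \<psi>) t / t ^ m) + \<mu> * 1)" by blast
      qed (auto intro!: continuous_intros balanced_pot_continuous_on)
      then show ?thesis by simp
    qed
    moreover have "pot m (V \<psi>) (1/4) \<le> pot m (V \<psi>) z"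
      using z adm \<mu> by (intro pot_V_antimono) (auto simp: flux_V_left admissible_def)
    ultimately show ?thesis using pot_V_half by simp
  qed
  have "(\<mu> / 4) ^ 3 * ((1/4) ^ (m + 1) - 0 ^ (m + 1)) / real (m + 1) \<le> H (1/4) - H 0"
    by (rule flux_cube_lower) (use quarter in auto)
  moreover have "H (1/4) \<le> H (1/2)" by (rule flux_cube_mono_left) auto
  moreover have "(- (\<mu> * 2 ^ m * \<tau>)) ^ 3 * (1 ^ (m + 1) - (1/2) ^ (m + 1)) / real (m + 1) \<le> H 1 - H (1/2)"
    by (rule flux_cube_lower) (use pot_V_right_lower in auto)
  moreover have "(- (\<mu> * 2 ^ m * \<tau>)) ^ 3 * (1 ^ (m + 1) - (1/2) ^ (m + 1)) / real (m + 1)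
      \<ge> - ((\<mu> * 2 ^ m * \<tau>) ^ 3 / real (m + 1))"
  proof -
    have "(\<mu> * 2 ^ m * \<tau>) ^ 3 * (1 ^ (m + 1) - (1/2) ^ (m + 1)) \<le> (\<mu> * 2 ^ m * \<tau>) ^ 3 * 1"
      using \<mu> \<tau> by (intro mult_left_mono) auto
    then have "(\<mu> * 2 ^ m * \<tau>) ^ 3 * (1 ^ (m + 1) - (1/2) ^ (m + 1)) / real (m + 1) \<le> (\<mu> * 2 ^ m * \<tau>) ^ 3 / real (m + 1)"
      by (intro divide_right_mono) auto
    then show ?thesis by simp
  qed
  moreover have "(\<mu> * 2 ^ m * \<tau>) ^ 3 / real (m + 1) < (\<mu> / 4) ^ 3 * ((1/4) ^ (m + 1) - 0 ^ (m + 1)) / real (m + 1)"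
  proof (rule divide_strict_right_mono)
    have "\<mu> ^ 3 * (2 ^ m * \<tau>) ^ 3 < \<mu> ^ 3 * ((1/4) ^ 3 * (1/4) ^ (m + 1))"
      using small \<mu> by (intro mult_strict_left_mono) auto
    then show "(\<mu> * 2 ^ m * \<tau>) ^ 3 < (\<mu> / 4) ^ 3 * ((1/4) ^ (m + 1) - 0 ^ (m + 1))"
      by (simp add: power_mult_distrib power_divide)
  qed simp
  ultimately show ?thesis by (simp add: flux_0)
qed

text \<open>If \<open>\<psi>\<close> sits within \<open>\<epsilon>\<close> of 1/2, the flux acts
  only over that length, is at most 1 and has weight at least \<open>(1/4) ^ m\<close>. The
  potential on the left is then at most \<open>4 ^ m * \<epsilon>\<close>, too little to compensate
  the loss on the right.\<close>

lemma flux_cube_negative: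
  assumes \<epsilon>: "0 < \<epsilon>" "\<epsilon> \<le> 1/4" and zero: "\<And>z. 0 \<le> z \<Longrightarrow> z \<le> 1/2 - \<epsilon> \<Longrightarrow> flux m \<psi> z = 0"
    and small: "(4 ^ m * \<epsilon>) ^ 3 < - (H 1 - H (1/2))"
  shows "H 1 < 0"
proof -
  have right: "pot m (V \<psi>) z \<le> 4 ^ m * \<epsilon>" if z: "1/2 - \<epsilon> \<le> z" "z \<le> 1/2" for z
  proof -
    have "flux m (V \<psi>) t \<le> 1" if t: "z < t" "t < 1/2" for t
    proof -
      have "\<mu> * flux m \<psi> t \<le> 1 * 1"
        using adm \<mu> t z \<epsilon> by (intro mult_mono) (auto simp: admissible_def)
      then show ?thesis using t z \<epsilon> by (simp add: flux_V_left)
    qed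
    then have "pot m (V \<psi>) z - pot m (V \<psi>) (1/2) \<le> 1 / z ^ m * (1/2 - z)"
      using z \<epsilon> by (intro pot_V_slope) auto
    also have "\<dots> \<le> 1 / (1/4) ^ m * \<epsilon>"
      using z \<epsilon> by (intro mult_mono divide_left_mono power_mono mult_pos_pos) auto
    finally show ?thesis using pot_V_half by (simp add: power_divide)
  qed
  have "pot m (V \<psi>) z \<le> 4 ^ m * \<epsilon>" if z: "0 \<le> z" "z \<le> 1/2" for z
  proof (cases "z \<le> 1/2 - \<epsilon>")
    case True
    then have "pot m (V \<psi>) z \<le> pot m (V \<psi>) (1/2 - \<epsilon>)"
      using z zero \<epsilon> by (intro pot_V_mono) (auto simp: flux_V_left)
    then show ?thesis using right[of "1/2 - \<epsilon>"] \<epsilon> by simp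
  qed (use right z in auto)
  then have "H (1/2) - H 0 \<le> (4 ^ m * \<epsilon>) ^ 3 * (1/2 - 0)"
    using \<epsilon> by (intro flux_cube_upper) auto
  moreover have "(4 ^ m * \<epsilon>) ^ 3 \<ge> 0" using \<epsilon> by simp
  moreover have "h < 0" if "g - 0 \<le> y * (1/2 - 0)" "0 \<le> y" "y < - (h - g)" for g h y :: real
    using that by (simp add: field_simps)
  ultimately show ?thesis using small unfolding flux_0 by blast
qed

end

text \<open>Beyond 1/2 the potential depends only on fluxes to which every admissible
  \<open>\<psi>\<close> contributes the same. So the loss on the right is known before
  \<open>\<epsilon>\<close> is chosen.\<close>

lemma flux_cube_right_eq:
  assumes "admissible \<psi>" "admissible \<psi>'"
  shows "flux m (\<lambda>z. pot m (V \<psi>) z ^ 3) 1 - flux m (\<lambda>z. pot m (V \<psi>) z ^ 3) (1/2)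
       = flux m (\<lambda>z. pot m (V \<psi>') z ^ 3) 1 - flux m (\<lambda>z. pot m (V \<psi>') z ^ 3) (1/2)"
proof -
  let ?H = "\<lambda>\<psi>. flux m (\<lambda>z. pot m (V \<psi>) z ^ 3)"
  have eq: "pot m (V \<psi>) z = pot m (V \<psi>') z" if "z \<ge> 1/2" for z
    unfolding pot_def using that assms
    by (intro integral_cong) (auto simp: flux_V admissible_def)
  have "?H \<psi> 1 - ?H \<psi>' 1 = ?H \<psi> (1/2) - ?H \<psi>' (1/2)"
  proof (rule has_derivative_zero_interval_constant[of "1/2" 1 "\<lambda>z. ?H \<psi> z - ?H \<psi>' z"])
    show "continuous_on {1/2..1} (\<lambda>z. ?H \<psi> z - ?H \<psi>' z)"
      by (intro continuous_on_diff continuous_on_subset[OF flux_continuous[OF regular_cube]] assms) auto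
    show "((\<lambda>z. ?H \<psi> z - ?H \<psi>' z) has_real_derivative 0) (at t)" if "1/2 < t" "t < 1" for t
      using DERIV_diff[OF flux_has_derivative[OF regular_cube[OF assms(1)], of t m]
          flux_has_derivative[OF regular_cube[OF assms(2)], of t m]] eq[of t] that by simp
  qed auto
  then show ?thesis by simp
qed

end

subsection \<open>Existence of the source\<close>

lemma exists_cubic_source:
  assumes e: "0 < e" "e \<le> 1/16"
    and l: "smooth {1-e<..<1+e} l" "\<And>z. z \<in> {1-e<..<1+e} \<Longrightarrow> l z > 0"
  obtains D a b d s where "cubic_source m D a b d (e/2) s l"
proof -
  \<comment> \<open>\<open>c\<close> is the right-hand side of the smallness condition in
    \<open>flux_cube_positive\<close>; \<open>\<tau>\<close> is chosen to make
    \<open>2 ^ m * \<tau> = c / 2\<close>, whose cube is below \<open>c\<close>.\<close>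
  define c where "c = (1/4 :: real) ^ (m + 4)"
  define \<tau> where "\<tau> = c / 2 ^ (m + 1)"
  have c: "0 < c" "c \<le> 1/256"
    using power_decreasing[of 4 "m + 4" "1/4 :: real"] by (auto simp: c_def power_divide)
  have \<tau>_small: "(2 ^ m * \<tau>) ^ 3 < (1/4) ^ 3 * (1/4) ^ (m + 1)"
  proof -
    have "2 ^ m * \<tau> = c / 2" by (simp add: \<tau>_def)
    moreover have "(c / 2) ^ 3 \<le> (c / 2) ^ 1" using c by (intro power_decreasing) auto
    moreover have "(1/4) ^ 3 * (1/4) ^ (m + 1) = c"
      unfolding c_def power_add[symmetric] by (rule arg_cong[where f = "\<lambda>n. (1/4) ^ n"]) simp
    ultimately show ?thesis using c by (simp only: power_one_right)
  qed
  have \<tau>: "0 < \<tau>" "\<tau> \<le> 1/8"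
  proof -
    have "\<tau> \<le> c / 1" unfolding \<tau>_def using c one_le_power[of "2 :: real" "m + 1"] by (intro divide_left_mono) auto
    then show "\<tau> \<le> 1/8" using c by simp
  qed (simp add: \<tau>_def c)
  \<comment> \<open>The point \<open>a\<close> has distance \<open>\<tau>/4\<close> both from 1/2
    and from the support of \<open>M\<close>, which leaves room for the exact cube around
    it.\<close>
  define a where "a = 1/2 + \<tau>/4"
  have a: "1/2 < a" "a \<le> 5/8" using \<tau> by (auto simp: a_def)
  obtain F where F: "smooth UNIV F" "\<And>z. z \<le> 1/8 \<Longrightarrow> F z = 1" "\<And>z. z \<ge> 1 \<Longrightarrow> F z = 0"
    "\<And>z. 0 \<le> z \<Longrightarrow> z < a \<Longrightarrow> F z > 0" "\<And>z. a < z \<Longrightarrow> z < 3/4 \<Longrightarrow> F z < 0" "\<And>z. 3/4 < z \<Longrightarrow> z < 1 \<Longrightarrow> F z > 0"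
    "\<And>z. 1/4 \<le> z \<Longrightarrow> z \<le> 7/8 \<Longrightarrow> F z = ((a - z) * (3/4 - z)) ^ 3"
    "\<And>z. z \<in> {1-e/2<..<1+e/2} \<Longrightarrow> F z = flat (1/3) (- 16/3) (1 - z\<^sup>2) * l z"
    using base_source[OF a e l] by blast
  have regF: "regular F" by (rule regular_smooth[OF F(1), of "1/8"]) (auto simp: F(2))
  \<comment> \<open>\<open>M\<close> sits where \<open>F\<close> is negative, \<open>R\<close>
    between 3/4 and the boundary zone, \<open>\<psi>1\<close> left of 1/2; adding
    \<open>\<psi>1\<close> and \<open>R\<close> and subtracting \<open>M\<close> therefore respects
    the signs of \<open>F\<close>.\<close>
  define M where "M = unit_bump m (1/2 + \<tau>/2) (1/2 + \<tau>)"
  define R where "R = unit_bump m (13/16) (7/8)"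
  define \<psi>1 where "\<psi>1 = unit_bump m (1/8) (1/4)"
  have Mb: "1/8 \<le> 1/2 + \<tau>/2" "1/2 + \<tau>/2 < 1/2 + \<tau>" "1/2 + \<tau> \<le> 1" using \<tau> by auto
  have Rb: "1/8 \<le> (13/16::real)" "13/16 < (7/8::real)" "7/8 \<le> (1::real)" by auto
  have \<psi>1b: "1/8 \<le> (1/8::real)" "1/8 < (1/4::real)" "1/4 \<le> (1::real)" by auto
  note regM = regular_unit_bump[OF Mb, of m, folded M_def]
  note regR = regular_unit_bump[OF Rb, of m, folded R_def]
  note reg1 = regular_unit_bump[OF \<psi>1b, of m, folded \<psi>1_def]
  note bM = flux_unit_bump_bounds[OF Mb, of _ m, folded M_def] flux_unit_bump_0[OF Mb, of _ m, folded M_def]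
    flux_unit_bump_1[OF Mb, of _ m, folded M_def]
  note bR = flux_unit_bump_bounds[OF Rb, of _ m, folded R_def] flux_unit_bump_0[OF Rb, of _ m, folded R_def]
    flux_unit_bump_1[OF Rb, of _ m, folded R_def]
  note b1 = flux_unit_bump_bounds[OF \<psi>1b, of _ m, folded \<psi>1_def] flux_unit_bump_0[OF \<psi>1b, of _ m, folded \<psi>1_def]
    flux_unit_bump_1[OF \<psi>1b, of _ m, folded \<psi>1_def]
  \<comment> \<open>Potentials at 1/2 of unit masses, ordered \<open>eR < eM < E\<close> since mass
    further out counts less. Every unit bump inside [1/8, 1/2] has the same value
    \<open>E\<close>.\<close>
  define E where "E = pot m \<psi>1 (1/2)"
  define eM where "eM = pot m M (1/2)"
  define eR where "eR = pot m R (1/2)"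
  have eM_E: "eM < E" unfolding eM_def E_def
    by (rule pot_less[OF reg1 regM, of _ "1/2" "1/2 + \<tau>/2"]) (use \<tau> bM b1 in auto)
  have eR_eM: "eR < eM" unfolding eM_def eR_def
  proof (rule pot_less[OF regM regR, of _ "1/2 + \<tau>" "13/16"])
    show "flux m R y \<le> flux m M y" if "1/2 \<le> y" for y
      using that bM[of y] bR[of y] \<tau> by (cases "y \<le> 13/16") (auto intro: order_trans)
  qed (use \<tau> bM bR in auto)
  define g0 where "g0 = flux m F 1"
  define eF where "eF = pot m F (1/2)"
  \<comment> \<open>\<open>\<rho>\<close> and \<open>\<mu>\<close> solve
    \<open>k * g0 + \<mu> - 1 + \<rho> = 0\<close> (flux at 1) and
    \<open>k * eF + \<mu> * E - eM + \<rho> * eR = 0\<close> (potential at 1/2). For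
    \<open>k = 0\<close> the ordering of the potentials gives \<open>0 < \<rho> < 1\<close>.\<close>
  define \<rho> where "\<rho> = (\<lambda>k. (E - eM + k * (eF - g0 * E)) * inverse (E - eR))"
  define \<mu> where "\<mu> = (\<lambda>k. 1 - \<rho> k - k * g0)"
  have \<rho>_mult: "\<rho> k * (E - eR) = E - eM + k * (eF - g0 * E)" for k
    using eM_E eR_eM by (simp add: \<rho>_def)
  have \<rho>0: "0 < \<rho> 0" "\<rho> 0 < 1" using eM_E eR_eM by (auto simp: \<rho>_def field_simps)
  interpret limit_source m \<tau> "\<mu> 0" "\<rho> 0" M R
  proof
    show "M z = 0" if "z \<ge> 1" for z unfolding M_def by (rule unit_bump_eq_0[OF Mb]) (use that \<tau> in auto)
    show "R z = 0" if "z \<ge> 1" for z unfolding R_def by (rule unit_bump_eq_0[OF Rb]) (use that in auto)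
    show "flux m M x \<le> flux m M y" if "0 \<le> x" "x \<le> y" for x y
      unfolding M_def by (rule flux_unit_bump_mono[OF Mb that])
  qed (use \<tau> \<rho>0 regM regR bM bR in \<open>auto simp: \<mu>_def\<close>)
  have adm: "admissible (unit_bump m l' r')" if lr: "1/8 \<le> l'" "l' < r'" "r' \<le> 1/2" for l' r'
  proof -
    have lr': "1/8 \<le> l'" "l' < r'" "r' \<le> 1" using lr by auto
    note u = regular_unit_bump[OF lr', of m] flux_unit_bump_bounds[OF lr', of _ m] flux_unit_bump_1[OF lr', of _ m]
    have "pot m (unit_bump m l' r') (1/2) = E"
      unfolding E_def pot_def by (intro integral_cong) (use u b1 lr in auto)
    then have "pot m (V (unit_bump m l' r')) (1/2) = \<mu> 0 * E + (- 1 * eM + \<rho> 0 * eR)"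
      unfolding V_def eM_def eR_def
      using pot_add[OF regular_cmult[OF u(1)] regular_add[OF regular_cmult[OF regM] regular_cmult[OF regR]], of "1/2" m "\<mu> 0" "-1" "\<rho> 0"]
        pot_add[OF regular_cmult[OF regM] regular_cmult[OF regR], of "1/2" m "-1" "\<rho> 0"]
      by (simp only: pot_cmult)
    also have "\<dots> = 0" using \<rho>_mult[of 0] by (simp add: \<mu>_def algebra_simps)
    finally show ?thesis
      unfolding admissible_def using u lr by (auto intro!: unit_bump_eq_0[OF lr'])
  qed
  have adm1: "admissible \<psi>1" unfolding \<psi>1_def by (rule adm) auto
  \<comment> \<open>\<open>K\<close> is the loss right of 1/2, common to all admissible
    \<open>\<psi>\<close>. Below, \<open>4 ^ m * \<epsilon> = x\<close> with \<open>x < 1\<close>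
    and \<open>x < K\<close>, hence \<open>x ^ 3 < K\<close>.\<close>
  define K where "K = flux m (\<lambda>z. pot m (V \<psi>1) z ^ 3) (1/2) - flux m (\<lambda>z. pot m (V \<psi>1) z ^ 3) 1"
  have K: "K > 0" using flux_cube_right_neg[OF adm1] by (simp add: K_def)
  define x where "x = min (1/4) (K/2)"
  define \<epsilon> where "\<epsilon> = x / 4 ^ m"
  have x: "0 < x" "x \<le> 1/4" "x < K" using K by (auto simp: x_def)
  have \<epsilon>: "0 < \<epsilon>" "\<epsilon> \<le> 1/4"
  proof -
    have "x / 4 ^ m \<le> x / 1" using x by (intro divide_left_mono) auto
    also have "\<dots> \<le> 1/4" using x by simp
    finally show "\<epsilon> \<le> 1/4" by (simp only: \<epsilon>_def)
  qed (use x in \<open>simp add: \<epsilon>_def\<close>)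
  have \<epsilon>_small: "(4 ^ m * \<epsilon>) ^ 3 < K"
  proof -
    have "x ^ 3 \<le> x ^ 1" using x by (intro power_decreasing) auto
    then show ?thesis using x by (simp add: \<epsilon>_def)
  qed
  define \<psi>2 where "\<psi>2 = unit_bump m (1/2 - \<epsilon>) (1/2)"
  have \<psi>2b: "1/8 \<le> 1/2 - \<epsilon>" "1/2 - \<epsilon> < 1/2" "1/2 \<le> (1::real)" using \<epsilon> by auto
  note reg2 = regular_unit_bump[OF \<psi>2b, of m, folded \<psi>2_def]
  have adm2: "admissible \<psi>2" unfolding \<psi>2_def by (rule adm) (use \<epsilon> in auto)
  \<comment> \<open>\<open>k\<close> weighs \<open>F\<close>, and \<open>t\<close> moves along the
    segment from \<open>\<psi>1\<close> to \<open>\<psi>2\<close>. Both linear conditions hold for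
    all \<open>k\<close> and \<open>t\<close>.\<close>
  define W where "W = (\<lambda>k t z. k * F z + (\<mu> k * ((1 - t) * \<psi>1 z + t * \<psi>2 z) + (- 1 * M z + \<rho> k * R z)))"
  have regs: "regular (\<lambda>z. k * F z)" "regular (\<lambda>z. (1 - t) * \<psi>1 z + t * \<psi>2 z)"
    "regular (\<lambda>z. \<mu> k * ((1 - t) * \<psi>1 z + t * \<psi>2 z))" "regular (\<lambda>z. (1 - t) * \<psi>1 z)" "regular (\<lambda>z. t * \<psi>2 z)"
    "regular (\<lambda>z. - 1 * M z)" "regular (\<lambda>z. \<rho> k * R z)" "regular (\<lambda>z. - 1 * M z + \<rho> k * R z)"
    "regular (\<lambda>z. \<mu> k * ((1 - t) * \<psi>1 z + t * \<psi>2 z) + (- 1 * M z + \<rho> k * R z))" for k t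
    by (intro regular_add regular_cmult regF reg1 reg2 regM regR)+
  have regW: "regular (W k t)" for k t
    unfolding W_def by (intro regular_add regs)
  have flux_W: "flux m (W k t) z = k * flux m F z + (\<mu> k * ((1 - t) * flux m \<psi>1 z + t * flux m \<psi>2 z)
      + (- 1 * flux m M z + \<rho> k * flux m R z))" for k t z
    unfolding W_def
    by (simp only: flux_add[OF regs(1) regs(9)] flux_add[OF regs(3) regs(8)] flux_add[OF regs(6,7)]
        flux_add[OF regs(4,5)] flux_cmult)
  have pot_W: "pot m (W k t) z = k * pot m F z + (\<mu> k * ((1 - t) * pot m \<psi>1 z + t * pot m \<psi>2 z)
      + (- 1 * pot m M z + \<rho> k * pot m R z))" if "z \<ge> 0" for k t z
    unfolding W_def
    by (simp only: pot_add[OF regs(1) regs(9) that] pot_add[OF regs(3) regs(8) that] pot_add[OF regs(6,7) that]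
        pot_add[OF regs(4,5) that] pot_cmult)
  have flux_W_1: "flux m (W k t) 1 = 0" for k t
  proof -
    have "flux m \<psi>1 1 = 1" "flux m \<psi>2 1 = 1" "flux m M 1 = 1" "flux m R 1 = 1"
      using adm1 adm2 bM[of 1] bR[of 1] \<tau> by (auto simp: admissible_def)
    then show ?thesis by (simp add: flux_W \<mu>_def g0_def algebra_simps)
  qed
  have pot_W_half: "pot m (W k t) (1/2) = 0" for k t
  proof -
    have "pot m \<psi>2 (1/2) = E"
      unfolding E_def pot_def by (intro integral_cong) (use adm1 adm2 in \<open>auto simp: admissible_def\<close>)
    then have "pot m (W k t) (1/2) = k * eF + (\<mu> k * ((1 - t) * E + t * E) + (- 1 * eM + \<rho> k * eR))"
      by (simp only: pot_W[of "1/2"] E_def[symmetric] eF_def eM_def eR_def)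
    also have "\<dots> = 0" using \<rho>_mult[of k] by (simp add: \<mu>_def algebra_simps)
    finally show ?thesis .
  qed
  define J where "J = (\<lambda>k t. flux m (\<lambda>z. pot m (W k t) z ^ 3) 1)"
  \<comment> \<open>Stated along continuous paths, to serve both as continuity in \<open>k\<close>
    for \<open>t = 0\<close> or \<open>t = 1\<close> and as continuity in \<open>t\<close> for fixed
    \<open>k\<close>.\<close>
  have contJ: "continuous_on UNIV (\<lambda>y. J (k y) (t y))"
    if kt: "continuous_on UNIV k" "continuous_on UNIV t" for k t :: "real \<Rightarrow> real"
  proof -
    let ?f = "\<lambda>y z. z ^ m * (k y * pot m F z + (\<mu> (k y) * ((1 - t y) * pot m \<psi>1 z + t y * pot m \<psi>2 z)
      + (- 1 * pot m M z + \<rho> (k y) * pot m R z))) ^ 3"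
    have "J (k y) (t y) = integral (cbox 0 1) (?f y)" for y
      unfolding J_def flux_def cbox_interval by (intro integral_cong) (simp add: pot_W)
    moreover have "continuous_on UNIV (\<lambda>y. integral (cbox 0 1) (?f y))"
    proof (rule integral_continuous_on_param)
      have P: "continuous_on (UNIV \<times> cbox 0 1) (\<lambda>p. pot m f (snd p))" if "regular f" for f
        by (rule continuous_on_compose2[OF pot_continuous[OF that]]) (auto intro: continuous_intros)
      have k: "continuous_on (UNIV \<times> cbox 0 (1::real)) (\<lambda>p. k (fst p))"
        "continuous_on (UNIV \<times> cbox 0 (1::real)) (\<lambda>p. t (fst p))"
        by (auto intro!: continuous_on_compose2[OF kt(1)] continuous_on_compose2[OF kt(2)] continuous_intros)
      show "continuous_on (UNIV \<times> cbox 0 1) (\<lambda>(y, z). ?f y z)"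
        unfolding case_prod_beta \<mu>_def \<rho>_def
        by (intro continuous_intros P k regF reg1 reg2 regM regR)
    qed
    ultimately show ?thesis by simp
  qed
  have "W 0 0 = V \<psi>1" "W 0 1 = V \<psi>2" by (auto simp: W_def V_def)
  moreover have "flux m (\<lambda>z. pot m (V \<psi>1) z ^ 3) 1 > 0"
    by (rule flux_cube_positive[OF adm1 _ \<tau>_small]) (use b1 in auto)
  moreover have "flux m (\<lambda>z. pot m (V \<psi>2) z ^ 3) 1 < 0"
  proof (rule flux_cube_negative[OF adm2 \<epsilon>])
    show "flux m \<psi>2 z = 0" if "0 \<le> z" "z \<le> 1/2 - \<epsilon>" for z
      unfolding \<psi>2_def by (rule flux_unit_bump_0[OF \<psi>2b that])
    show "(4 ^ m * \<epsilon>) ^ 3 < - (flux m (\<lambda>z. pot m (V \<psi>2) z ^ 3) 1 - flux m (\<lambda>z. pot m (V \<psi>2) z ^ 3) (1/2))"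
      using \<epsilon>_small flux_cube_right_eq[OF adm1 adm2] by (simp add: K_def)
  qed
  ultimately have J0: "J 0 0 > 0" "- J 0 1 > 0" by (auto simp: J_def)
  have near0: "\<forall>\<^sub>F k in nhds 0. f k > 0" if "continuous_on UNIV f" "f 0 > 0" for f :: "real \<Rightarrow> real"
  proof -
    have "isCont f 0" using that by (simp add: continuous_on_eq_continuous_at)
    then show ?thesis
      using that(2) by (auto simp: isCont_def tendsto_at_iff_tendsto_nhds intro: order_tendstoD)
  qed
  \<comment> \<open>The strict inequalities at \<open>k = 0\<close> survive for a small positive
    \<open>k\<close>, which is then frozen; afterwards only \<open>t\<close> varies.\<close>
  have "\<forall>\<^sub>F k in nhds 0. J k 0 > 0 \<and> - J k 1 > 0 \<and> \<rho> k > 0 \<and> \<mu> k > 0"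
  proof (intro eventually_conj near0)
    show "continuous_on UNIV (\<lambda>k. J k 0)" "continuous_on UNIV (\<lambda>k. - J k 1)"
      by (intro contJ[of "\<lambda>k. k" "\<lambda>k. 0"] continuous_on_minus contJ[of "\<lambda>k. k" "\<lambda>k. 1"] continuous_intros)+
    show "continuous_on UNIV \<rho>" "continuous_on UNIV \<mu>"
      unfolding \<mu>_def \<rho>_def by (intro continuous_intros)+
  qed (use J0 \<rho>0 in \<open>auto simp: \<mu>_def\<close>)
  then obtain q where q: "q > 0" "\<And>k. dist k 0 < q \<Longrightarrow> J k 0 > 0 \<and> - J k 1 > 0 \<and> \<rho> k > 0 \<and> \<mu> k > 0"
    by (auto simp: eventually_nhds_metric)
  define k where "k = q / 2"
  have k: "k > 0" "J k 0 > 0" "J k 1 < 0" "\<rho> k > 0" "\<mu> k > 0"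
    using q(1) q(2)[of k] by (auto simp: k_def)
  have "\<exists>t\<ge>0. t \<le> 1 \<and> J k t = 0"
    using k contJ[of "\<lambda>_. k" "\<lambda>t. t"]
    by (intro IVT2') (auto intro: continuous_on_subset)
  then obtain t where t: "0 \<le> t" "t \<le> 1" "J k t = 0" by blast
  \<comment> \<open>Division by \<open>k\<close> gives \<open>F\<close> the coefficient 1, so its
    germs at \<open>a\<close>, 3/4 and 1 are met exactly; the homogeneous conditions are
    unaffected.\<close>
  define D where "D = (\<lambda>z. inverse k * W k t z)"
  define S where "S = (\<lambda>z. \<mu> k * ((1 - t) * \<psi>1 z + t * \<psi>2 z))"
  have S: "S z \<ge> 0" for z
    unfolding S_def \<psi>1_def \<psi>2_def using k t
    by (intro mult_nonneg_nonneg add_nonneg_nonneg unit_bump_nonneg[OF \<psi>1b] unit_bump_nonneg[OF \<psi>2b]) auto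
  have S0: "S z = 0" if "z \<le> 1/8 \<or> z \<ge> 1/2" for z
  proof -
    have "\<psi>1 z = 0" "\<psi>2 z = 0"
      unfolding \<psi>1_def \<psi>2_def using that \<epsilon> \<psi>2b
      by (auto intro!: unit_bump_eq_0[OF \<psi>1b] unit_bump_eq_0[OF \<psi>2b])
    then show ?thesis by (simp add: S_def)
  qed
  have Mn: "M z \<ge> 0" for z unfolding M_def by (rule unit_bump_nonneg[OF Mb])
  have M0: "M z = 0" if "z \<le> 1/2 + \<tau>/2 \<or> 1/2 + \<tau> \<le> z" for z
    unfolding M_def by (rule unit_bump_eq_0[OF Mb that])
  have Rn: "R z \<ge> 0" for z unfolding R_def by (rule unit_bump_nonneg[OF Rb])
  have R0: "R z = 0" if "z \<le> 13/16 \<or> 7/8 \<le> z" for z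
    unfolding R_def by (rule unit_bump_eq_0[OF Rb that])
  have D: "D z = F z + inverse k * (S z - M z + \<rho> k * R z)" for z
    using k by (simp add: D_def W_def S_def algebra_simps)
  have plain: "D z = F z" if "S z = 0" "M z = 0" "R z = 0" for z
    using that by (simp add: D)
  have "cubic_source m D a (3/4) 1 (e/2) (\<tau>/4) l"
  proof
    show "regular D" unfolding D_def by (intro regular_cmult regW)
    show "D z = 0" if "z \<ge> 1" for z using that \<tau> by (simp add: D F(3) S0 M0 R0)
    show "flux m D 1 = 0" unfolding D_def flux_cmult by (simp add: flux_W_1)
    show "1/2 < a" by (rule a)
    show "a < 3/4" using a by simp
    show "3/4 < 1 - e/2" "0 < e/2" using e by auto
    show "smooth {0<..} D"
      unfolding D_def W_def M_def R_def \<psi>1_def \<psi>2_def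
      by (intro smooth_mult smooth_add smooth_const smooth_subset[OF F(1)] smooth_subset[OF smooth_unit_bump]) (use Mb Rb \<psi>1b \<psi>2b in auto)
    show "D z = 1" if "z < 1/8" for z
      using that \<tau> by (simp add: D F(2) S0 M0 R0)
    show "D z > 0" if "0 \<le> z" "z < a" for z
      using F(4)[OF that] that k S[of z] \<tau> by (simp add: D a_def M0 R0 add_pos_nonneg)
    show "D z < 0" if "a < z" "z < 3/4" for z
    proof -
      have "0 \<le> inverse k * M z" using k Mn[of z] by simp
      then have "F z < inverse k * M z" using F(5)[OF that] by linarith
      then show ?thesis using that a by (simp add: D S0 R0)
    qed
    show "D z > 0" if "3/4 < z" "z < 1" for z
      using F(6)[OF that] that k Rn[of z] \<tau> by (simp add: D S0 M0 add_pos_nonneg)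
    show "0 < \<tau>/4" using \<tau> by simp
    show "D z = ((a - z) * (3/4 - z)) ^ 3" if "\<bar>z - a\<bar> < \<tau>/4 \<or> \<bar>z - 3/4\<bar> < \<tau>/4" for z
    proof -
      \<comment> \<open>Within \<open>\<tau>/4\<close> of \<open>a\<close> or of 3/4 all bumps
        vanish, so \<open>D\<close> equals \<open>F\<close> there.\<close>
      have "z \<ge> 1/2 \<and> z \<le> 13/16 \<and> (z \<le> 1/2 + \<tau>/2 \<or> 1/2 + \<tau> \<le> z)"
        using that \<tau> unfolding a_def abs_less_iff by auto
      then show ?thesis using F(7)[of z] by (simp add: plain S0 M0 R0)
    qed
    show "smooth {1-e/2<..<1+e/2} l" by (rule smooth_subset[OF l(1)]) (use e in auto)
    show "l z > 0" if "z \<in> {1-e/2<..<1+e/2}" for z using l(2)[of z] that e by auto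
    show "D z = flat (1/3) (- 16/3) (1 - z\<^sup>2) * l z" if "z \<in> {1-e/2<..<1+e/2}" for z
    proof -
      have "S z = 0" "M z = 0" "R z = 0" using that e \<tau> by (auto intro!: S0 M0 R0)
      then show ?thesis using F(8)[OF that] by (simp only: plain)
    qed
    show "0 < (1::real)" by simp
    show "pot m D (1/2) = 0" unfolding D_def pot_cmult pot_W_half by simp
    show "flux m (\<lambda>z. pot m D z ^ 3) 1 = 0"
      using t(3) unfolding D_def pot_cmult power_mult_distrib flux_cmult J_def by simp
  qed
  then show thesis by (rule that)
qed

section \<open>Assembly of \<open>A\<close>, \<open>B\<close> and \<open>C\<close>\<close>

theorem proposition3:
  fixes N :: nat
  assumes "N > 0"
  shows "\<exists>A B C :: real \<Rightarrow> real. \<exists>\<delta>\<^sub>A :: real.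
    A \<in> C_infinity \<and> B \<in> C_infinity \<and> C \<in> C_infinity \<and> \<delta>\<^sub>A \<in> {0<..<1/2} \<and>
    (supp A \<subseteq> {-1..1} \<and> supp B \<subseteq> {-1..1} \<and> supp C \<subseteq> {-1..1}) \<and>
    {z. z > 0 \<and> B z \<noteq> 0 \<and> C z \<noteq> 0} \<noteq> {} \<and>
    (\<forall>z. A z = A (-z) \<and> B z = B (-z) \<and> C z = C (-z)) \<and>
    (\<forall>z. 1 - \<delta>\<^sub>A < z \<and> z < 1 \<longrightarrow> A z = exp (- (1 / (1 - z\<^sup>2)))) \<and>
    (\<forall>z. z \<noteq> 0 \<longrightarrow> - deriv (deriv A) z - (real N - 1) / z * deriv A z = (B z) ^ 3) \<and>
    (\<forall>z. z \<noteq> 0 \<longrightarrow> - deriv (deriv B) z - (real N - 1) / z * deriv B z = (C z) ^ 3) \<and>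
    (\<forall>z. (B z = 0 \<and> z \<in> {0..<1}) \<longleftrightarrow> z = 1/2) \<and>
    deriv B (1/2) < 0 \<and>
    C (1/2) > 0 \<and>
    (\<forall>z. (C z = 0 \<and> z \<in> {0..<1}) \<longrightarrow> (z \<in> {0<..<1} \<and> deriv C z \<noteq> 0))"
proof -
  obtain m where N: "N = Suc m" using assms gr0_implies_Suc by blast
  obtain e b l where e_bounds: "0 < e" "e \<le> 1/16" and
    l_pos: "smooth {1-e<..<1+e} l" "\<And>z. z \<in> {1-e<..<1+e} \<Longrightarrow> l z > 0" and
    profile_B: "\<And>d f z. d \<le> e \<Longrightarrow> balanced m f
       \<Longrightarrow> (\<And>z. z \<in> {1-d<..<1} \<Longrightarrow> f z = flat (1/3) (- 16/3) (1 - z\<^sup>2) * l z)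
       \<Longrightarrow> 1 - d < z \<Longrightarrow> z < 1 \<Longrightarrow> pot m f z = b z" and
    profile_A: "\<And>d f z. d \<le> e \<Longrightarrow> balanced m f \<Longrightarrow> (\<And>z. z \<in> {1-d<..<1} \<Longrightarrow> f z = b z ^ 3)
       \<Longrightarrow> 1 - d < z \<Longrightarrow> z < 1 \<Longrightarrow> pot m f z = exp (- (1 / (1 - z\<^sup>2)))"
    by (rule boundary_profile[of m]) blast
  obtain D a b' d s where "cubic_source m D a b' d (e/2) s l"
    using exists_cubic_source[OF e_bounds l_pos] by blast
  then interpret cubic_source m D a b' d "e/2" s l .
  let ?A = "\<lambda>z. pot m (\<lambda>z. B z ^ 3) \<bar>z\<bar>" and ?B = "\<lambda>z. B \<bar>z\<bar>" and ?C = "\<lambda>z. C \<bar>z\<bar>"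
  \<comment> \<open>\<open>D\<close> has its prescribed germ only on the interval of half width;
    there the germ of \<open>B\<close>, and from it that of \<open>A\<close>, follow by
    uniqueness.\<close>
  have half: "e/2 \<le> e" using e_bounds by simp
  have B_near_1: "B z = b z" if "1 - e/2 < z" "z < 1" for z
    by (rule profile_B[OF half D.balanced_axioms _ that]) (use D_near_1 in auto)
  have A_near_1: "pot m (\<lambda>z. B z ^ 3) z = exp (- (1 / (1 - z\<^sup>2)))" if "1 - e/2 < z" "z < 1" for z
    by (rule profile_A[OF half BB.balanced_axioms _ that]) (use B_near_1 in auto)
  show ?thesis
  proof (rule exI[of _ ?A], rule exI[of _ ?B], rule exI[of _ ?C], rule exI[of _ "e/2"], intro conjI allI impI)
    show "?A \<in> C_infinity" by (rule BB.C_infinity_pot[OF smooth_power[OF smooth_pot_D]])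
    show "?B \<in> C_infinity" by (rule D.C_infinity_pot[OF smooth_D])
    show "?C \<in> C_infinity" by (rule C_infinity_C)
    show "e/2 \<in> {0<..<1/2}" using e_bounds by auto
    show "supp ?A \<subseteq> {-1..1}" by (rule supp_subset[OF BB.pot_vanish])
    show "supp ?B \<subseteq> {-1..1}" by (rule supp_subset[OF D.pot_vanish])
    show "supp ?C \<subseteq> {-1..1}" by (rule supp_subset) (simp add: C_def D.vanish)
    \<comment> \<open>1/4 lies left of 1/2 and of \<open>a\<close>, where \<open>B\<close> and
      \<open>C\<close> are positive.\<close>
    have "B (1/4) \<noteq> 0" "C (1/4) \<noteq> 0"
      using pot_pos[of "1/4"] D_signs(1)[of "1/4"] ab by (auto simp: C_def)
    then have "1/4 \<in> {z. z > 0 \<and> ?B z \<noteq> 0 \<and> ?C z \<noteq> 0}" by simp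
    then show "{z. z > 0 \<and> ?B z \<noteq> 0 \<and> ?C z \<noteq> 0} \<noteq> {}" by blast
    show "?A z = exp (- (1 / (1 - z\<^sup>2)))" if "1 - e/2 < z \<and> z < 1" for z
      using A_near_1[of z] that e_bounds by simp
    show "- deriv (deriv ?A) z - (real N - 1) / z * deriv ?A z = ?B z ^ 3" if "z \<noteq> 0" for z
      using BB.pot_even_equation[OF that] by (simp add: N)
    show "- deriv (deriv ?B) z - (real N - 1) / z * deriv ?B z = ?C z ^ 3" if "z \<noteq> 0" for z
      using D.pot_even_equation[OF that] by (simp add: N C_def odd_real_root_pow)
    show "(?B z = 0 \<and> z \<in> {0..<1}) \<longleftrightarrow> z = 1/2" for z by (rule B_zero_iff)
    show "deriv ?B (1/2) < 0" by (rule deriv_B_half)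
    show "?C (1/2) > 0" using D_signs(1)[of "1/2"] ab by (simp add: C_def)
    show "z \<in> {0<..<1}" "deriv ?C z \<noteq> 0" if "?C z = 0 \<and> z \<in> {0..<1}" for z
      using deriv_C_nonzero[of z] that by auto
  qed auto
qed

end
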